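(* For any $\delta\in(0,1)$ and any function $f:\mathbb{F}_2^n\to[-1,1]$ of Fourier degree $d$, we have $$\mathsf{r}(f,\delta)\le n-\Omega\!\left(n^{1/d!}\,\big(\log(n/\delta)\big)^{-2}\right).$$
   Context: For $f:\mathbb{F}_2^n\to\mathbb{R}$ and $\gamma\in\mathbb{F}_2^n$, $\hat f(\gamma)=\mathbb{E}_{x\in\mathbb{F}_2^n}[f(x)(-1)^{\langle\gamma,x\rangle}]$, so $f(x)=\sum_\gamma\hat f(\gamma)(-1)^{\langle\gamma,x\rangle}$. Writing $\|\gamma\|_1$ for the Hamming weight, the (Fourier) degree of $f$ is $\max\{\|\gamma\|_1:\hat f(\gamma)\neq 0\}$. For a linear subspace $\mathcal V$, $\mathcal V^\perp=\{\gamma:\langle\gamma,v\rangle=0\ \forall v\in\mathcal V\}$. For an affine subspace $\mathcal U=\alpha+\mathcal V$, the restriction $f_{\mathcal U}:\mathcal V\to\mathbb R$ is $f_{\mathcal U}(x)=f(x+\alpha)$. Choose a subspace $\mathcal W$ with $\mathcal W\cap\mathcal V^\perp=\{0\}$ and $\mathcal W+\mathcal V^\perp=\mathbb F_2^n$; for $\gamma\in\mathcal W$ set $\hat{f_{\mathcal U}}(\gamma)=\mathbb E_{x\in\mathcal V}[f(x+\alpha)(-1)^{\langle\gamma,x\rangle}]$. The function $f_{\mathcal U}$ is $\delta$-regular if $|\hat{f_{\mathcal U}}(\gamma)|\le\delta$ for all nonzero $\gamma\in\mathcal W$ (this does not depend on the choices of $\mathcal W$ and $\alpha$). Define $\mathsf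 r(f,\delta)=\min\{\operatorname{codim}(\mathcal U):\mathcal U\text{ an affine subspace of }\mathbb F_2^n\text{ with }f_{\mathcal U}\ \delta\text{-regular}\}$, where $\operatorname{codim}(\mathcal U)=n-\dim(\mathcal U)$. Logarithms are base 2; the $\Omega$ hides a constant independent of $n$ and $\delta$.
   Formalization: The term Ω(g) is read as the integer part of c·g, with c > 0 depending only on d, and n ≥ 2 is assumed; without rounding the bound fails for δ tiny relative to n, and for n = 1 it fails as δ tends to 1. *)

theory Defs
  imports
    "HOL-Analysis.Analysis"
    "HOL-Library.Function_Algebras"
    "HOL-Library.Z2"
begin

text \<open>
  The dimension \<open>n\<close> is quantified inside the theorem, below a constant that must not depend on
  it, so \<open>\<bbbF>\<^sub>2\<^sup>n\<close> is a carrier set rather than a type: the sequences over the two-element field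
  \<open>bit\<close> that vanish outside \<open>{..<n}\<close>. It is a subspace of the vector space of all sequences,
  whose \<open>subspace\<close> and \<open>dim\<close> are those of the library locale \<open>vector_space\<close>.
\<close>

definition f2_scale :: "bit \<Rightarrow> (nat \<Rightarrow> bit) \<Rightarrow> nat \<Rightarrow> bit" where
  "f2_scale c x = (\<lambda>i. c * x i)"

global_interpretation f2: vector_space f2_scale
  by unfold_locales (auto simp: f2_scale_def fun_eq_iff algebra_simps)

definition F2 :: "nat \<Rightarrow> (nat \<Rightarrow> bit) set" where
  "F2 n = {x. \<forall>i\<ge>n. x i = 0}"

definition ip :: "nat \<Rightarrow> (nat \<Rightarrow> bit) \<Rightarrow> (nat \<Rightarrow> bit) \<Rightarrow> bit" where
  "ip n \<gamma> x = (\<Sum>i<n. \<gamma> i * x i)"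

definition character :: "nat \<Rightarrow> (nat \<Rightarrow> bit) \<Rightarrow> (nat \<Rightarrow> bit) \<Rightarrow> real" where
  "character n \<gamma> x = (if ip n \<gamma> x = 0 then 1 else -1)"

definition fourier :: "nat \<Rightarrow> ((nat \<Rightarrow> bit) \<Rightarrow> real) \<Rightarrow> (nat \<Rightarrow> bit) \<Rightarrow> real" where
  "fourier n f \<gamma> = (\<Sum>x\<in>F2 n. f x * character n \<gamma> x) / real (card (F2 n))"

definition hamming_weight :: "nat \<Rightarrow> (nat \<Rightarrow> bit) \<Rightarrow> nat" where
  "hamming_weight n \<gamma> = card {i. i < n \<and> \<gamma> i \<noteq> 0}"

text \<open>Inserting \<open>0\<close> only matters for \<open>f = 0\<close>, which is thereby given degree \<open>0\<close>.\<close>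

definition fourier_degree :: "nat \<Rightarrow> ((nat \<Rightarrow> bit) \<Rightarrow> real) \<Rightarrow> nat" where
  "fourier_degree n f = Max (insert 0 {hamming_weight n \<gamma> | \<gamma>. \<gamma> \<in> F2 n \<and> fourier n f \<gamma> \<noteq> 0})"

definition perp :: "nat \<Rightarrow> (nat \<Rightarrow> bit) set \<Rightarrow> (nat \<Rightarrow> bit) set" where
  "perp n V = {\<gamma> \<in> F2 n. \<forall>v\<in>V. ip n \<gamma> v = 0}"

definition perp_complement :: "nat \<Rightarrow> (nat \<Rightarrow> bit) set \<Rightarrow> (nat \<Rightarrow> bit) set \<Rightarrow> bool" where
  "perp_complement n V W \<longleftrightarrow> f2.subspace W \<and> W \<subseteq> F2 n \<and>
     W \<inter> perp n V = {0} \<and> {w + u | w u. w \<in> W \<and> u \<in> perp n V} = F2 n"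

definition restr_fourier ::
    "nat \<Rightarrow> ((nat \<Rightarrow> bit) \<Rightarrow> real) \<Rightarrow> (nat \<Rightarrow> bit) \<Rightarrow> (nat \<Rightarrow> bit) set \<Rightarrow> (nat \<Rightarrow> bit) \<Rightarrow> real" where
  "restr_fourier n f \<alpha> V \<gamma> = (\<Sum>x\<in>V. f (x + \<alpha>) * character n \<gamma> x) / real (card V)"

text \<open>
  An affine subspace \<open>\<U> = \<alpha> + \<V>\<close> is given by the pair \<open>\<alpha>\<close>, \<open>V\<close>. The complement \<open>W\<close> always exists,
  and which one is chosen is immaterial: \<^term>\<open>restr_fourier n f \<alpha> V\<close> is constant on the cosets of
  \<^term>\<open>perp n V\<close>, and the nonzero elements of any complement represent exactly its nontrivial cosets.
  Replacing \<open>\<alpha>\<close> by another element of \<open>\<U>\<close> only changes signs of the coefficients.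
\<close>

definition delta_regular ::
    "nat \<Rightarrow> ((nat \<Rightarrow> bit) \<Rightarrow> real) \<Rightarrow> real \<Rightarrow> (nat \<Rightarrow> bit) \<Rightarrow> (nat \<Rightarrow> bit) set \<Rightarrow> bool" where
  "delta_regular n f \<delta> \<alpha> V \<longleftrightarrow>
     (\<exists>W. perp_complement n V W \<and> (\<forall>\<gamma>\<in>W. \<gamma> \<noteq> 0 \<longrightarrow> \<bar>restr_fourier n f \<alpha> V \<gamma>\<bar> \<le> \<delta>))"

definition regular_codim :: "nat \<Rightarrow> ((nat \<Rightarrow> bit) \<Rightarrow> real) \<Rightarrow> real \<Rightarrow> nat" where
  "regular_codim n f \<delta> = Min {n - f2.dim V | \<alpha> V.
     \<alpha> \<in> F2 n \<and> f2.subspace V \<and> V \<subseteq> F2 n \<and> delta_regular n f \<delta> \<alpha> V}"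

text \<open>
  A bound \<open>n - \<Omega>(g)\<close> on \<^const>\<open>regular_codim\<close> is rendered as \<open>n - \<lfloor>c * g\<rfloor>\<close>. Without the
  floor it fails whenever \<open>\<delta>\<close> is tiny compared with \<open>n\<close>: the degree-one function
  \<open>\<Sum>i<n. (-1)^x\<^sub>i / 2^(i+1)\<close> is injective, so it is then \<open>\<delta>\<close>-regular only on single points and
  the codimension is exactly \<open>n\<close>. Up to changing \<open>c\<close>, the floored bound is the same as
  \<open>n - c * g\<close> in the range \<open>c * g \<ge> 1\<close>. The case \<open>n = 1\<close> must be left out because \<open>log 2 (n / \<delta>)\<close>
  is then not bounded away from \<open>0\<close>.
\<close>

end

theory Submission
  imports Defs
begin

text \<open>
  Identify \<open>r\<close> coordinates of a block, after negating some and fixing others, with a single one. By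
  pigeonhole over the \<open>2 ^ r\<close> subsets of the block this can be done so that \<open>K\<close> prescribed linear
  forms in the signs become at most \<open>\<epsilon>\<close>, provided that \<open>r\<close> is about \<open>K * log (n / \<epsilon>)\<close>. If \<open>m\<close>
  blocks are treated one after the other, the forms being the new degree-\<open>k\<close> coefficients on the
  merged coordinates, then \<open>K \<le> m ^ (k - 1)\<close>. Hence about \<open>m ^ k * log (n / \<epsilon>)\<close> coordinates
  suffice to leave \<open>m\<close> coordinates on which the degree-\<open>k\<close> part is uniformly tiny; it is discarded
  and the degree drops to \<open>k - 1\<close>. In the end the function is within \<open>\<delta>\<close> of a constant, and the
  logarithm has been lost with exponent \<open>1/1! + \<dots> + 1/d! < 2\<close>.
\<close>

text \<open>Keeps arithmetic in \<open>bit\<close> in ring form, so that ring rules and the rules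
  for finite sums and products apply instead of those for bit operations.\<close>

declare add_bit_eq_xor [simp del] mult_bit_eq_and [simp del] minus_bit_def [simp del]
  bit_not_zero_iff [simp del] bit_not_one_iff [simp del]

section \<open>Fourier coefficients on a cube with an arbitrary set of coordinates\<close>

text \<open>The coordinates left after merging form an arbitrary finite set of naturals, so the
  carrier is indexed by a set instead of a dimension; \<open>F2 n\<close> is
  \<open>cube {..<n}\<close>.\<close>

definition cube :: "nat set \<Rightarrow> (nat \<Rightarrow> bit) set" where
  "cube J = {y. \<forall>i. i \<notin> J \<longrightarrow> y i = 0}"

definition sg :: "bit \<Rightarrow> real" where
  "sg c = (if c = 0 then 1 else -1)"

definition chi :: "nat set \<Rightarrow> (nat \<Rightarrow> bit) \<Rightarrow> real" where
  "chi S y = (\<Prod>i\<in>S. sg (y i))"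

definition coef :: "nat set \<Rightarrow> ((nat \<Rightarrow> bit) \<Rightarrow> real) \<Rightarrow> nat set \<Rightarrow> real" where
  "coef J F S = (\<Sum>y\<in>cube J. F y * chi S y) / 2 ^ card J"

text \<open>An upper bound instead of the exact degree: top coefficients may cancel under a
  restriction, and only the bound is inherited.\<close>

definition deg_le :: "nat set \<Rightarrow> ((nat \<Rightarrow> bit) \<Rightarrow> real) \<Rightarrow> nat \<Rightarrow> bool" where
  "deg_le J F k \<longleftrightarrow> (\<forall>S. S \<subseteq> J \<longrightarrow> k < card S \<longrightarrow> coef J F S = 0)"

lemma sg_0 [simp]: "sg 0 = 1"
  by (simp add: sg_def)

lemma sg_add: "sg (a + b) = sg a * sg b"
  by (cases a; cases b) (simp_all add: sg_def)

lemma sg_mult_self [simp]: "sg a * sg a = 1"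
  by (simp add: sg_def)

lemma abs_sg [simp]: "\<bar>sg a\<bar> = 1"
  by (simp add: sg_def)

lemma sg_power: "sg a ^ m = (if odd m then sg a else 1)"
  by (auto simp: sg_def)

lemma sg_sum: "sg (\<Sum>i\<in>A. f i) = (\<Prod>i\<in>A. sg (f i))"
  by (induction A rule: infinite_finite_induct) (simp_all add: sg_add)

lemma chi_add: "chi S (\<lambda>i. x i + y i) = chi S x * chi S y"
  by (simp add: chi_def sg_add prod.distrib)

lemma abs_chi [simp]: "\<bar>chi S y\<bar> = 1"
  by (simp add: chi_def abs_prod)

lemma chi_empty [simp]: "chi {} y = 1"
  by (simp add: chi_def)

lemma chi_eq_1: "(\<And>i. i \<in> S \<Longrightarrow> y i = 0) \<Longrightarrow> chi S y = 1"
  by (simp add: chi_def)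

lemma chi_flip:
  assumes "finite S"
  shows "chi S (y(i := y i + 1)) = (if i \<in> S then - chi S y else chi S y)"
proof (cases "i \<in> S")
  case True
  have "(\<Prod>j\<in>S - {i}. sg ((y(i := y i + 1)) j)) = (\<Prod>j\<in>S - {i}. sg (y j))"
    by (rule prod.cong) auto
  moreover have "sg (y i + 1) = - sg (y i)"
    by (simp add: sg_add) (simp add: sg_def)
  ultimately show ?thesis
    using True assms unfolding chi_def by (simp add: prod.remove[of S i])
next
  case False
  then show ?thesis
    unfolding chi_def by (auto intro!: prod.cong)
qed

section \<open>Orthogonality and Fourier inversion\<close>

lemma bij_betw_cube: "bij_betw (\<lambda>A i. if i \<in> A then 1 else 0) (Pow J) (cube J)"
proof (rule bij_betw_byWitness[where f' = "\<lambda>y. {i. y i = 1}"])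
  show "\<forall>y\<in>cube J. (\<lambda>i. if i \<in> {i. y i = 1} then 1 else 0) = y"
    by (auto simp: fun_eq_iff bit_not_one_iff)
qed (auto simp: cube_def)

lemma finite_cube: "finite J \<Longrightarrow> finite (cube J)"
  using bij_betw_finite[OF bij_betw_cube] by auto

lemma card_cube: "finite J \<Longrightarrow> card (cube J) = 2 ^ card J"
  using bij_betw_same_card[OF bij_betw_cube, of J] by (simp add: card_Pow)

text \<open>If \<open>i\<close> lies in exactly one of \<open>S\<close> and \<open>T\<close>,
  flipping coordinate \<open>i\<close> permutes the cube and negates the summand, so the sum equals
  its own negative.\<close>

lemma chi_orthogonal:
  assumes fin: "finite J" and "S \<subseteq> J" "T \<subseteq> J"
  shows "(\<Sum>y\<in>cube J. chi S y * chi T y) = (if S = T then 2 ^ card J else 0)"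
proof (cases "S = T")
  case True
  have "chi T y * chi T y = 1" for y
    by (simp add: chi_def flip: prod.distrib)
  with True show ?thesis
    by (simp add: card_cube fin)
next
  case False
  then obtain i where i: "i \<in> J" "i \<in> S \<longleftrightarrow> i \<notin> T"
    using assms by blast
  have fS: "finite S" "finite T"
    using assms finite_subset by blast+
  have inv: "(y(i := y i + 1))(i := (y(i := y i + 1)) i + 1) = y" for y :: "nat \<Rightarrow> bit"
    by (auto simp: fun_eq_iff add.assoc)
  have flip: "y(i := y i + 1) \<in> cube J" if "y \<in> cube J" for y
    using that \<open>i \<in> J\<close> by (simp add: cube_def)
  have bij: "bij_betw (\<lambda>y. y(i := y i + 1)) (cube J) (cube J)"
    by (rule bij_betw_byWitness[where f' = "\<lambda>y. y(i := y i + 1)"]) (use flip inv in blast)+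
  have "(\<Sum>y\<in>cube J. chi S y * chi T y) =
      (\<Sum>y\<in>cube J. chi S (y(i := y i + 1)) * chi T (y(i := y i + 1)))"
    by (rule sum.reindex_bij_betw[OF bij, symmetric])
  also have "\<dots> = (\<Sum>y\<in>cube J. - (chi S y * chi T y))"
    using i by (intro sum.cong) (auto simp: chi_flip fS)
  finally show ?thesis
    using False by (simp add: sum_negf)
qed

text \<open>Summed over all \<open>S\<close>, the kernel \<open>chi S z * chi S y\<close> factors as
  the product of \<open>sg (z i) * sg (y i) + 1\<close> over \<open>i\<close> in \<open>J\<close>;
  one factor vanishes as soon as \<open>z\<close> and \<open>y\<close> differ.\<close>

lemma coef_expansion:
  assumes fin: "finite J" and y: "y \<in> cube J"
  shows "F y = (\<Sum>S\<in>Pow J. coef J F S * chi S y)"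
proof -
  have delta: "(\<Sum>S\<in>Pow J. chi S z * chi S y) = (if z = y then 2 ^ card J else 0)"
    if z: "z \<in> cube J" for z
  proof -
    have "(\<Sum>S\<in>Pow J. chi S z * chi S y) = (\<Sum>S\<in>Pow J. \<Prod>i\<in>S. sg (z i) * sg (y i))"
      by (simp add: chi_def prod.distrib)
    also have "\<dots> = (\<Prod>i\<in>J. sg (z i) * sg (y i) + 1)"
      by (simp add: prod_add[OF fin])
    also have "\<dots> = (if z = y then 2 ^ card J else 0)"
    proof (cases "z = y")
      case False
      then obtain i where i: "z i \<noteq> y i"
        by (auto simp: fun_eq_iff)
      then have "i \<in> J"
        using z y unfolding cube_def by (metis (mono_tags) mem_Collect_eq)
      moreover have "sg (z i) * sg (y i) + 1 = 0"
        using i by (cases "z i"; cases "y i") (auto simp: sg_def)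
      ultimately show ?thesis
        using False fin by (auto intro!: prod_zero)
    qed simp
    finally show ?thesis .
  qed
  have "(\<Sum>S\<in>Pow J. coef J F S * chi S y) =
      (\<Sum>S\<in>Pow J. \<Sum>z\<in>cube J. F z * (chi S z * chi S y)) / 2 ^ card J"
    by (simp add: coef_def sum_divide_distrib sum_distrib_right mult.assoc)
  also have "(\<Sum>S\<in>Pow J. \<Sum>z\<in>cube J. F z * (chi S z * chi S y)) =
      (\<Sum>z\<in>cube J. F z * (\<Sum>S\<in>Pow J. chi S z * chi S y))"
    by (subst sum.swap) (simp add: sum_distrib_left)
  also have "\<dots> = (\<Sum>z\<in>cube J. if z = y then F z * 2 ^ card J else 0)"
    by (intro sum.cong) (auto simp: delta)
  also have "\<dots> = F y * 2 ^ card J"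
    using y finite_cube[OF fin] by simp
  finally show ?thesis
    by simp
qed

text \<open>Orthogonality picks out \<open>a S\<close>. The coefficients of a restricted function
  are computed below by exhibiting an expansion and appealing to this uniqueness.\<close>

lemma coef_unique:
  assumes fin: "finite J" and S: "S \<subseteq> J"
    and F: "\<And>y. y \<in> cube J \<Longrightarrow> F y = (\<Sum>T\<in>Pow J. a T * chi T y)"
  shows "coef J F S = a S"
proof -
  have "(\<Sum>y\<in>cube J. F y * chi S y) = (\<Sum>y\<in>cube J. \<Sum>T\<in>Pow J. a T * (chi T y * chi S y))"
    by (intro sum.cong) (simp_all add: F sum_distrib_right mult.assoc)
  also have "\<dots> = (\<Sum>T\<in>Pow J. a T * (\<Sum>y\<in>cube J. chi T y * chi S y))"
    by (subst sum.swap) (simp add: sum_distrib_left)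
  also have "\<dots> = (\<Sum>T\<in>Pow J. if T = S then a T * 2 ^ card J else 0)"
    using S by (intro sum.cong) (auto simp: chi_orthogonal[OF fin])
  also have "\<dots> = a S * 2 ^ card J"
    using S fin by simp
  finally show ?thesis
    by (simp add: coef_def)
qed

lemma abs_coef_le:
  assumes fin: "finite J" and F: "\<And>y. y \<in> cube J \<Longrightarrow> \<bar>F y\<bar> \<le> M"
  shows "\<bar>coef J F S\<bar> \<le> M"
proof -
  have "\<bar>\<Sum>y\<in>cube J. F y * chi S y\<bar> \<le> (\<Sum>y\<in>cube J. M)"
  proof (rule order_trans[OF sum_abs sum_mono])
    show "\<bar>F y * chi S y\<bar> \<le> M" if "y \<in> cube J" for y
      using F[OF that] by (simp add: abs_mult)
  qed
  then show ?thesis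
    by (simp add: coef_def card_cube[OF fin] divide_le_eq mult.commute)
qed

section \<open>Restrictions to parametrised affine subspaces\<close>

text \<open>
  The affine subspace consists of the points \<open>\<alpha> + y \<circ> b\<close>. As \<open>y\<close> vanishes outside \<open>J'\<close>, an index
  \<open>i\<close> with \<open>b i \<notin> J'\<close> is a coordinate that is fixed to \<open>\<alpha> i\<close>.
\<close>

definition reduces ::
    "nat set \<Rightarrow> ((nat \<Rightarrow> bit) \<Rightarrow> real) \<Rightarrow> nat set \<Rightarrow> ((nat \<Rightarrow> bit) \<Rightarrow> real) \<Rightarrow> bool" where
  "reduces J F J' G \<longleftrightarrow> J' \<subseteq> J \<and> (\<exists>\<alpha>\<in>cube J. \<exists>b. (\<forall>j\<in>J'. b j = j) \<and> (\<forall>i. i \<notin> J \<longrightarrow> b i \<notin> J') \<and>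
     (\<forall>y\<in>cube J'. G y = F (\<lambda>i. \<alpha> i + y (b i))))"

lemma subst_in_cube:
  "\<alpha> \<in> cube J \<Longrightarrow> (\<And>i. i \<notin> J \<Longrightarrow> b i \<notin> J') \<Longrightarrow> y \<in> cube J' \<Longrightarrow> (\<lambda>i. \<alpha> i + y (b i)) \<in> cube J"
  by (auto simp: cube_def)

lemma reducesI:
  assumes "J' \<subseteq> J" "\<alpha> \<in> cube J" "\<And>j. j \<in> J' \<Longrightarrow> b j = j" "\<And>i. i \<notin> J \<Longrightarrow> b i \<notin> J'"
    and "\<And>y. y \<in> cube J' \<Longrightarrow> G y = F (\<lambda>i. \<alpha> i + y (b i))"
  shows "reduces J F J' G"
  unfolding reduces_def
  by (intro conjI bexI[of _ \<alpha>] exI[of _ b] ballI allI impI) (fact assms | simp add: assms)+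

lemma reducesE:
  assumes "reduces J F J' G"
  obtains \<alpha> b where "J' \<subseteq> J" "\<alpha> \<in> cube J" "\<And>j. j \<in> J' \<Longrightarrow> b j = j" "\<And>i. i \<notin> J \<Longrightarrow> b i \<notin> J'"
    "\<And>y. y \<in> cube J' \<Longrightarrow> G y = F (\<lambda>i. \<alpha> i + y (b i))"
  using assms unfolding reduces_def by (elim conjE bexE exE) (rule that; simp)

lemma zero_in_cube: "(\<lambda>_. 0) \<in> cube J"
  by (simp add: cube_def)

lemma reduces_subset: "J' \<subseteq> J \<Longrightarrow> reduces J F J' F"
  by (rule reducesI[OF _ zero_in_cube, of J' J id]) auto

lemma reduces_trans:
  assumes "reduces J F J' G" "reduces J' G J'' H"
  shows "reduces J F J'' H"
proof -
  obtain \<alpha> b where 1: "J' \<subseteq> J" "\<alpha> \<in> cube J" "\<And>j. j \<in> J' \<Longrightarrow> b j = j"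
      "\<And>i. i \<notin> J \<Longrightarrow> b i \<notin> J'" "\<And>y. y \<in> cube J' \<Longrightarrow> G y = F (\<lambda>i. \<alpha> i + y (b i))"
    using reducesE[OF assms(1)] by metis
  obtain \<alpha>' b' where 2: "J'' \<subseteq> J'" "\<alpha>' \<in> cube J'" "\<And>j. j \<in> J'' \<Longrightarrow> b' j = j"
      "\<And>i. i \<notin> J' \<Longrightarrow> b' i \<notin> J''" "\<And>y. y \<in> cube J'' \<Longrightarrow> H y = G (\<lambda>i. \<alpha>' i + y (b' i))"
    using reducesE[OF assms(2)] by metis
  show ?thesis
  proof (rule reducesI[where b = "b' \<circ> b" and \<alpha> = "\<lambda>i. \<alpha> i + \<alpha>' (b i)"])
    show "(\<lambda>i. \<alpha> i + \<alpha>' (b i)) \<in> cube J"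
      using subst_in_cube[of \<alpha> J b J' \<alpha>'] 1 2 by blast
    show "H y = F (\<lambda>i. (\<alpha> i + \<alpha>' (b i)) + y ((b' \<circ> b) i))" if y: "y \<in> cube J''" for y
      using 2(5)[OF y] 1(5)[OF subst_in_cube[OF 2(2,4) y]] by (simp add: add.assoc)
    show "J'' \<subseteq> J"
      using 1(1) 2(1) by blast
    show "(b' \<circ> b) j = j" if "j \<in> J''" for j
      using that 1(3) 2(1,3) by (metis comp_apply subsetD)
    show "(b' \<circ> b) i \<notin> J''" if "i \<notin> J" for i
      using that 1(4) 2(4) by (metis comp_apply)
  qed
qed

lemma reduces_bounded:
  assumes "reduces J F J' G" and F: "\<And>y. y \<in> cube J \<Longrightarrow> \<bar>F y\<bar> \<le> M" and y: "y \<in> cube J'"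
  shows "\<bar>G y\<bar> \<le> M"
proof -
  obtain \<alpha> b where "\<alpha> \<in> cube J" "\<And>i. i \<notin> J \<Longrightarrow> b i \<notin> J'"
      and G: "\<And>y. y \<in> cube J' \<Longrightarrow> G y = F (\<lambda>i. \<alpha> i + y (b i))"
    using reducesE[OF assms(1)] by metis
  then show ?thesis
    using F[OF subst_in_cube[of \<alpha> J b J' y]] y by simp
qed

section \<open>Fourier coefficients after an identification of coordinates\<close>

definition odd_fibres :: "(nat \<Rightarrow> nat) \<Rightarrow> nat set \<Rightarrow> nat set \<Rightarrow> nat set" where
  "odd_fibres b J' S = {j\<in>J'. odd (card {i\<in>S. b i = j})}"

lemma odd_fibres_subset: "odd_fibres b J' S \<subseteq> b ` S"
  by (auto simp: odd_fibres_def) (metis (mono_tags, lifting) card.empty empty_Collect_eq even_zero image_eqI)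

text \<open>The sign of \<open>y j\<close> occurs once for every \<open>i\<close> in
  \<open>S\<close> with \<open>b i = j\<close>. Signs square to one, so only the parity of the fibre
  matters, and fibres over points outside \<open>J'\<close> contribute nothing because
  \<open>y\<close> vanishes there.\<close>

lemma chi_comp:
  assumes fin: "finite S" and y: "y \<in> cube J'"
  shows "chi S (\<lambda>i. y (b i)) = chi (odd_fibres b J' S) y"
proof -
  have "chi S (\<lambda>i. y (b i)) = (\<Prod>j\<in>b ` S. \<Prod>i\<in>{i\<in>S. b i = j}. sg (y (b i)))"
    unfolding chi_def by (rule prod.image_gen[OF fin])
  also have "\<dots> = (\<Prod>j\<in>b ` S. sg (y j) ^ card {i\<in>S. b i = j})"
    by (intro prod.cong) auto
  also have "\<dots> = (\<Prod>j\<in>odd_fibres b J' S. sg (y j) ^ card {i\<in>S. b i = j})"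
  proof (rule prod.mono_neutral_right)
    show "\<forall>j\<in>b ` S - odd_fibres b J' S. sg (y j) ^ card {i \<in> S. b i = j} = 1"
      using y by (auto simp: odd_fibres_def sg_power cube_def)
  qed (use fin odd_fibres_subset in auto)
  also have "\<dots> = chi (odd_fibres b J' S) y"
    unfolding chi_def by (intro prod.cong) (auto simp: odd_fibres_def sg_power)
  finally show ?thesis .
qed

text \<open>Characters that become equal after the substitution are collected;
  \<open>chi S \<alpha>\<close> is the sign produced by the shift.\<close>

lemma coef_subst:
  assumes fin: "finite J" and "J' \<subseteq> J" and \<alpha>: "\<alpha> \<in> cube J" and b: "\<And>i. i \<notin> J \<Longrightarrow> b i \<notin> J'"
    and T: "T \<subseteq> J'"
  shows "coef J' (\<lambda>y. F (\<lambda>i. \<alpha> i + y (b i))) T =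
    (\<Sum>S\<in>{S\<in>Pow J. odd_fibres b J' S = T}. coef J F S * chi S \<alpha>)"
proof (rule coef_unique[OF _ T])
  show fin': "finite J'"
    using assms finite_subset by blast
  fix y assume y: "y \<in> cube J'"
  have "F (\<lambda>i. \<alpha> i + y (b i)) = (\<Sum>S\<in>Pow J. coef J F S * chi S (\<lambda>i. \<alpha> i + y (b i)))"
    by (rule coef_expansion[OF fin subst_in_cube[OF \<alpha> b y]])
  also have "\<dots> = (\<Sum>S\<in>Pow J. coef J F S * chi S \<alpha> * chi (odd_fibres b J' S) y)"
    using fin finite_subset[OF _ fin] y
    by (intro sum.cong) (auto simp: chi_add chi_comp mult.assoc)
  also have "\<dots> = (\<Sum>T\<in>Pow J'. \<Sum>S\<in>{S\<in>Pow J. odd_fibres b J' S = T}.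
      coef J F S * chi S \<alpha> * chi (odd_fibres b J' S) y)"
    using fin fin' by (intro sum.group[symmetric]) (auto simp: odd_fibres_def)
  also have "\<dots> = (\<Sum>T\<in>Pow J'. (\<Sum>S\<in>{S\<in>Pow J. odd_fibres b J' S = T}. coef J F S * chi S \<alpha>) * chi T y)"
    by (simp add: sum_distrib_right)
  finally show "F (\<lambda>i. \<alpha> i + y (b i)) = \<dots>" .
qed

lemma card_odd_fibres_le: "finite S \<Longrightarrow> card (odd_fibres b J' S) \<le> card S"
  by (meson card_image_le card_mono finite_imageI odd_fibres_subset order_trans)

text \<open>A substitution never lengthens a character, as \<open>odd_fibres b J' S\<close> has at
  most \<open>card S\<close> elements; a long \<open>T\<close> therefore arises only from long
  \<open>S\<close>.\<close>

lemma deg_le_subst: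
  assumes "finite J" "J' \<subseteq> J" "\<alpha> \<in> cube J" "\<And>i. i \<notin> J \<Longrightarrow> b i \<notin> J'" and deg: "deg_le J F k"
  shows "deg_le J' (\<lambda>y. F (\<lambda>i. \<alpha> i + y (b i))) k"
  unfolding deg_le_def
proof (intro allI impI)
  fix T assume T: "T \<subseteq> J'" "k < card T"
  have "coef J F S = 0" if "S \<subseteq> J" "odd_fibres b J' S = T" for S
    using that deg T card_odd_fibres_le[of S b J'] finite_subset[OF that(1) \<open>finite J\<close>]
    unfolding deg_le_def by auto
  then show "coef J' (\<lambda>y. F (\<lambda>i. \<alpha> i + y (b i))) T = 0"
    by (subst coef_subst[OF assms(1-4) T(1)]) (auto intro!: sum.neutral)
qed

text \<open>A set \<open>S\<close> with odd fibres \<open>T\<close> has at least \<open>k\<close>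
  elements. Larger ones have coefficient zero by the degree bound, and those of size
  \<open>k\<close> are mapped bijectively onto \<open>T\<close>.\<close>

lemma coef_subst_top:
  assumes fin: "finite J" and "J' \<subseteq> J" "\<alpha> \<in> cube J" "\<And>i. i \<notin> J \<Longrightarrow> b i \<notin> J'" and deg: "deg_le J F k"
    and T: "T \<subseteq> J'" and card: "card T = k"
  shows "coef J' (\<lambda>y. F (\<lambda>i. \<alpha> i + y (b i))) T =
    (\<Sum>S\<in>{S\<in>Pow J. card S = k \<and> b ` S = T}. coef J F S * chi S \<alpha>)"
proof (subst coef_subst[OF assms(1-4) T], assumption, rule sum.mono_neutral_right)
  show "{S \<in> Pow J. card S = k \<and> b ` S = T} \<subseteq> {S \<in> Pow J. odd_fibres b J' S = T}"
  proof
    fix S assume "S \<in> {S \<in> Pow J. card S = k \<and> b ` S = T}"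
    then have S: "S \<subseteq> J" "card S = k" "b ` S = T"
      by auto
    have "finite S"
      using S(1) fin finite_subset by blast
    then have "inj_on b S"
      using S card by (intro eq_card_imp_inj_on) auto
    then have "{i\<in>S. b i = b j} = {j}" if "j \<in> S" for j
      using that by (auto dest: inj_onD)
    then have "b j \<in> odd_fibres b J' S" if "j \<in> S" for j
      using T S(3) that by (auto simp: odd_fibres_def)
    then have "odd_fibres b J' S = T"
      using odd_fibres_subset S(3) by blast
    with S(1) show "S \<in> {S \<in> Pow J. odd_fibres b J' S = T}"
      by simp
  qed
  show "\<forall>S\<in>{S \<in> Pow J. odd_fibres b J' S = T} - {S \<in> Pow J. card S = k \<and> b ` S = T}.
      coef J F S * chi S \<alpha> = 0"
  proof
    fix S assume "S \<in> {S \<in> Pow J. odd_fibres b J' S = T} - {S \<in> Pow J. card S = k \<and> b ` S = T}"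
    then have S: "S \<subseteq> J" "odd_fibres b J' S = T" and *: "\<not> (card S = k \<and> b ` S = T)"
      by auto
    have fS: "finite S"
      using S(1) fin finite_subset by blast
    have "k < card S"
    proof (rule ccontr)
      assume "\<not> k < card S"
      then have "card (b ` S) \<le> card T" "card S = k"
        using card_image_le[OF fS, of b] card_odd_fibres_le[OF fS, of b J'] card S by auto
      moreover have "T \<subseteq> b ` S"
        using odd_fibres_subset[of b J' S] S(2) by simp
      ultimately show False
        using * card_seteq[of "b ` S" T] fS by auto
    qed
    with deg S show "coef J F S * chi S \<alpha> = 0"
      by (auto simp: deg_le_def)
  qed
qed (use fin in auto)

lemma deg_le_reduces:
  assumes red: "reduces J F J' G" and fin: "finite J" and deg: "deg_le J F k"
  shows "deg_le J' G k"
proof -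
  obtain \<alpha> b where *: "J' \<subseteq> J" "\<alpha> \<in> cube J" "\<And>i. i \<notin> J \<Longrightarrow> b i \<notin> J'"
      and G: "\<And>y. y \<in> cube J' \<Longrightarrow> G y = F (\<lambda>i. \<alpha> i + y (b i))"
    using reducesE[OF red] by metis
  have "coef J' G = coef J' (\<lambda>y. F (\<lambda>i. \<alpha> i + y (b i)))"
    by (simp add: coef_def fun_eq_iff G)
  then show ?thesis
    using deg_le_subst[OF fin * deg] by (simp add: deg_le_def)
qed

text \<open>Setting the coordinates outside \<open>J'\<close> to zero merges \<open>T\<close> only
  with proper supersets, which exceed the degree bound.\<close>

lemma coef_subset_top:
  assumes "finite J" "J' \<subseteq> J" "deg_le J F k" "T \<subseteq> J'" "card T = k"
  shows "coef J' F T = coef J F T"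
proof -
  have "coef J' F T = (\<Sum>S\<in>{S\<in>Pow J. card S = k \<and> id ` S = T}. coef J F S * chi S (\<lambda>_. 0))"
    using coef_subst_top[of J J' "\<lambda>_. 0" id F k T] assms by (auto simp: zero_in_cube)
  moreover have "{S\<in>Pow J. card S = k \<and> id ` S = T} = {T}"
    using assms by auto
  ultimately show ?thesis
    by (simp add: chi_eq_1)
qed

section \<open>Making the coefficients of top degree small\<close>

text \<open>Rounding the \<open>card A\<close> sums down to multiples of \<open>\<epsilon>\<close>
  leaves at most \<open>(2 * Q + 1) ^ card A\<close> patterns, fewer than there are subsets of
  \<open>B\<close>. Two subsets with the same pattern have all their sums within
  \<open>\<epsilon>\<close> of each other.\<close>

lemma signed_sums_pigeonhole:
  fixes c :: "'a \<Rightarrow> 'b \<Rightarrow> real"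
  assumes fin: "finite A" "finite B" and \<epsilon>: "0 < \<epsilon>"
    and bound: "\<And>t i. t \<in> A \<Longrightarrow> i \<in> B \<Longrightarrow> \<bar>c t i\<bar> \<le> M"
    and M: "0 \<le> M"
    and Q: "M * card B / \<epsilon> + 1 \<le> real Q"
    and small: "(2 * Q + 1) ^ card A < 2 ^ card B"
  shows "\<exists>X\<subseteq>B. \<exists>Y\<subseteq>B. X \<noteq> Y \<and> (\<forall>t\<in>A. \<bar>sum (c t) X - sum (c t) Y\<bar> \<le> \<epsilon>)"
proof -
  \<comment> \<open>\<open>restrict\<close> puts \<open>h X\<close> into an extensional function
    space, whose cardinality is a power.\<close>
  define h where "h X = restrict (\<lambda>t. \<lfloor>sum (c t) X / \<epsilon>\<rfloor>) A" for X
  have sum_le: "\<bar>sum (c t) X / \<epsilon>\<bar> \<le> real Q - 1" if "t \<in> A" "X \<subseteq> B" for t X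
  proof -
    have "\<bar>sum (c t) X\<bar> \<le> (\<Sum>i\<in>X. M)"
      using that bound by (intro order_trans[OF sum_abs] sum_mono) auto
    also have "\<dots> \<le> M * card B"
      using that fin M card_mono[of B X] by (simp add: mult.commute mult_left_mono)
    finally have "\<bar>sum (c t) X\<bar> / \<epsilon> \<le> M * card B / \<epsilon>"
      using \<epsilon> by (simp add: divide_right_mono)
    then show ?thesis
      using Q \<epsilon> by simp
  qed
  have "h X \<in> A \<rightarrow>\<^sub>E {- int Q..int Q}" if "X \<subseteq> B" for X
    unfolding h_def
  proof (rule restrict_PiE_iff[THEN iffD2], rule ballI)
    fix t assume "t \<in> A"
    from sum_le[OF this that] show "\<lfloor>sum (c t) X / \<epsilon>\<rfloor> \<in> {- int Q..int Q}"
      unfolding atLeastAtMost_iff by linarith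
  qed
  then have "card (h ` Pow B) \<le> card (A \<rightarrow>\<^sub>E {- int Q..int Q})"
    using fin by (intro card_mono finite_PiE) auto
  also have "\<dots> = (2 * Q + 1) ^ card A"
  proof -
    have "nat (int Q + 1 + int Q) = 2 * Q + 1"
      by simp
    then show ?thesis
      using fin by (simp add: card_PiE)
  qed
  also have "\<dots> < card (Pow B)"
    using small fin by (simp add: card_Pow)
  finally have "\<not> inj_on h (Pow B)"
    by (rule pigeonhole)
  then obtain X Y where XY: "X \<subseteq> B" "Y \<subseteq> B" "X \<noteq> Y" "h X = h Y"
    unfolding inj_on_def by blast
  have "\<bar>sum (c t) X - sum (c t) Y\<bar> \<le> \<epsilon>" if "t \<in> A" for t
  proof -
    have "\<lfloor>sum (c t) X / \<epsilon>\<rfloor> = \<lfloor>sum (c t) Y / \<epsilon>\<rfloor>"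
      using fun_cong[OF XY(4), of t] that by (simp add: h_def)
    then have "\<bar>sum (c t) X / \<epsilon> - sum (c t) Y / \<epsilon>\<bar> \<le> 1"
      by linarith
    then show ?thesis
      using \<epsilon> by (simp add: diff_divide_distrib[symmetric])
  qed
  with XY show ?thesis
    by blast
qed

text \<open>
  The coordinates on which \<open>X\<close> and \<open>Y\<close> differ are identified with a single one, after those in
  \<open>Y - X\<close> have been negated, so that the new coefficients are the differences of the sums over
  \<open>X\<close> and \<open>Y\<close>. Only sets with at most one element in \<open>B\<close> contribute to them, as the degree is
  at most \<open>Suc k\<close>.
\<close>

lemma merge_block:
  assumes fin: "finite J" and N: "N \<subseteq> J" and B: "B \<subseteq> J - N" and deg: "deg_le J F (Suc k)"
    and F: "\<And>y. y \<in> cube J \<Longrightarrow> \<bar>F y\<bar> \<le> M" and M: "0 \<le> M" and \<epsilon>: "0 < \<epsilon>"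
    and Q: "M * card B / \<epsilon> + 1 \<le> real Q"
    and small: "(2 * Q + 1) ^ (card N choose k) < 2 ^ card B"
  obtains i0 G where "i0 \<in> B" "reduces J F (insert i0 (J - B)) G"
    "\<And>T. T \<subseteq> N \<Longrightarrow> card T = k \<Longrightarrow> \<bar>coef (insert i0 (J - B)) G (insert i0 T)\<bar> \<le> \<epsilon>"
    "\<And>T. T \<subseteq> N \<Longrightarrow> card T = Suc k \<Longrightarrow> coef (insert i0 (J - B)) G T = coef J F T"
proof -
  define A where "A = {T. T \<subseteq> N \<and> card T = k}"
  have finN: "finite N" and finB: "finite B"
    using fin N B finite_subset by blast+
  have A: "finite A" "card A = card N choose k"
    unfolding A_def using finN n_subsets by auto
  \<comment> \<open>A sign attached to coordinate \<open>i\<close> of the block enters the new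
    coefficient at \<open>insert i0 T\<close> with weight \<open>c T i\<close>; each
    \<open>T\<close> in \<open>A\<close> is thus one linear form to be made small.\<close>
  define c where "c T i = coef J F (insert i T)" for T i
  have bound: "\<bar>c T i\<bar> \<le> M" for T i
    unfolding c_def by (rule abs_coef_le[OF fin F])
  have "(2 * Q + 1) ^ card A < 2 ^ card B"
    using small A(2) by simp
  then have "\<exists>X\<subseteq>B. \<exists>Y\<subseteq>B. X \<noteq> Y \<and> (\<forall>T\<in>A. \<bar>sum (c T) X - sum (c T) Y\<bar> \<le> \<epsilon>)"
    by (rule signed_sums_pigeonhole[of A B \<epsilon> c M Q, OF A(1) finB \<epsilon> bound M Q])
  then obtain X Y where XY: "X \<subseteq> B" "Y \<subseteq> B" "X \<noteq> Y"
      and close: "\<And>T. T \<in> A \<Longrightarrow> \<bar>sum (c T) X - sum (c T) Y\<bar> \<le> \<epsilon>"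
    by blast
  define v where "v = (X - Y) \<union> (Y - X)"
  have finXY: "finite X" "finite Y"
    using XY finB by (auto intro: finite_subset)
  have vB: "v \<subseteq> B"
    using XY by (auto simp: v_def)
  obtain i0 where i0: "i0 \<in> v"
    using XY by (auto simp: v_def)
  \<comment> \<open>\<open>i0\<close> survives as the representative of \<open>v\<close>. The
    coordinates of \<open>B\<close> outside \<open>v\<close> do not belong to \<open>J'\<close> and
    are fixed to \<open>0\<close>.\<close>
  define J' where "J' = insert i0 (J - B)"
  define \<alpha> :: "nat \<Rightarrow> bit" where "\<alpha> = (\<lambda>i. if i \<in> Y - X then 1 else 0)"
  define b where "b = (\<lambda>i. if i \<in> v then i0 else i)"
  define G where "G = (\<lambda>y. F (\<lambda>i. \<alpha> i + y (b i)))"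
  have J': "J' \<subseteq> J"
    using B vB i0 by (auto simp: J'_def)
  have \<alpha>: "\<alpha> \<in> cube J"
    using XY B by (auto simp: \<alpha>_def cube_def)
  have b_out: "b i \<notin> J'" if "i \<notin> J" for i
    using that J' vB B by (auto simp: b_def)
  have b_id: "b j = j" if "j \<in> J'" for j
    using that vB i0 by (auto simp: b_def J'_def)
  have NJ': "N \<subseteq> J'" and bN: "\<And>j. j \<in> N \<Longrightarrow> b j = j" and i0N: "i0 \<notin> N" and vN: "v \<inter> N = {}"
    using N B vB i0 by (auto simp: J'_def b_def)
  have \<alpha>N: "\<alpha> i = 0" if "i \<in> N" for i
    using that XY B by (auto simp: \<alpha>_def)
  have top: "coef J' G T = (\<Sum>S\<in>{S\<in>Pow J. card S = Suc k \<and> b ` S = T}. coef J F S * chi S \<alpha>)"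
    if "T \<subseteq> J'" "card T = Suc k" for T
    unfolding G_def by (rule coef_subst_top[OF fin J' \<alpha> b_out deg that])
  have red: "reduces J F J' G"
    by (rule reducesI[OF J' \<alpha> b_id b_out]) (simp_all add: G_def)
  have new: "\<bar>coef J' G (insert i0 T)\<bar> \<le> \<epsilon>" if T: "T \<subseteq> N" "card T = k" for T
  proof -
    have finT: "finite T"
      using T finN finite_subset by blast
    have card_ins: "card (insert i T) = Suc k" if "i \<in> v" for i
      using that vN T finT by (subst card_insert_disjoint) auto
    \<comment> \<open>At top degree \<open>b\<close> is injective on \<open>S\<close>, so exactly
      one element of \<open>S\<close> lies in \<open>v\<close>, and \<open>b\<close> fixes the
      others, which must then form \<open>T\<close>.\<close>
    have preimage: "{S\<in>Pow J. card S = Suc k \<and> b ` S = insert i0 T} = (\<lambda>i. insert i T) ` v"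
    proof (intro equalityI subsetI)
      fix S assume "S \<in> {S\<in>Pow J. card S = Suc k \<and> b ` S = insert i0 T}"
      then have S: "S \<subseteq> J" "card S = Suc k" "b ` S = insert i0 T"
        by auto
      have finS: "finite S"
        using S fin finite_subset by blast
      have inj: "inj_on b S"
        using S card_ins[OF i0] finS by (intro eq_card_imp_inj_on) auto
      obtain i where i: "i \<in> S" "b i = i0"
        using S(3) by (metis imageE insertI1)
      then have iv: "i \<in> v"
        using i0 by (auto simp: b_def split: if_splits)
      have "S \<subseteq> insert i T"
      proof
        fix s assume s: "s \<in> S"
        show "s \<in> insert i T"
        proof (cases "s = i")
          case False
          then have "b s \<noteq> i0"
            using inj s i by (metis inj_onD)
          moreover have "b s \<in> insert i0 T"
            using S(3) s by blast
          ultimately show ?thesis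
            by (auto simp: b_def split: if_splits)
        qed simp
      qed
      then have "S = insert i T"
        using card_ins[OF iv] S(2) finT by (intro card_subset_eq) auto
      then show "S \<in> (\<lambda>i. insert i T) ` v"
        using iv by blast
    next
      fix S assume "S \<in> (\<lambda>i. insert i T) ` v"
      then obtain i where i: "i \<in> v" "S = insert i T"
        by blast
      have "b ` T = T"
        using bN T by force
      then show "S \<in> {S\<in>Pow J. card S = Suc k \<and> b ` S = insert i0 T}"
        using i card_ins[OF i(1)] vB B N T by (auto simp: b_def)
    qed
    have inj: "inj_on (\<lambda>i. insert i T) v"
      using vN T by (intro inj_onI) blast
    have "insert i0 T \<subseteq> J'"
      using T NJ' by (auto simp: J'_def)
    then have "coef J' G (insert i0 T) = (\<Sum>i\<in>v. coef J F (insert i T) * chi (insert i T) \<alpha>)"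
      using top[of "insert i0 T"] card_ins[OF i0] preimage by (simp add: sum.reindex[OF inj])
    also have "\<dots> = (\<Sum>i\<in>v. coef J F (insert i T) * sg (\<alpha> i))"
    proof (intro sum.cong refl)
      fix i assume "i \<in> v"
      then have "i \<notin> T"
        using vN T by blast
      moreover have "chi T \<alpha> = 1"
        using \<alpha>N T by (intro chi_eq_1) auto
      ultimately show "coef J F (insert i T) * chi (insert i T) \<alpha> = coef J F (insert i T) * sg (\<alpha> i)"
        using finT by (simp add: chi_def)
    qed
    also have "\<dots> = (\<Sum>i\<in>X - Y. coef J F (insert i T) * sg (\<alpha> i)) + (\<Sum>i\<in>Y - X. coef J F (insert i T) * sg (\<alpha> i))"
      unfolding v_def using finXY by (intro sum.union_disjoint) auto
    also have "(\<Sum>i\<in>X - Y. coef J F (insert i T) * sg (\<alpha> i)) = (\<Sum>i\<in>X - Y. coef J F (insert i T))"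
      by (intro sum.cong) (auto simp: \<alpha>_def)
    also have "(\<Sum>i\<in>Y - X. coef J F (insert i T) * sg (\<alpha> i)) = (\<Sum>i\<in>Y - X. - coef J F (insert i T))"
      by (intro sum.cong) (auto simp: \<alpha>_def sg_def)
    \<comment> \<open>The intersection of \<open>X\<close> and \<open>Y\<close> cancels, which turns
      the signed sum over \<open>v\<close> into a difference of two full sums.\<close>
    also have "(\<Sum>i\<in>X - Y. coef J F (insert i T)) + \<dots> =
        (\<Sum>i\<in>X. coef J F (insert i T)) - (\<Sum>i\<in>Y. coef J F (insert i T))"
      using sum.Int_Diff[OF finXY(1), of "\<lambda>i. coef J F (insert i T)" Y]
        sum.Int_Diff[OF finXY(2), of "\<lambda>i. coef J F (insert i T)" X]
      by (simp add: sum_negf Int_commute)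
    finally show ?thesis
      using close[of T] T by (simp add: A_def c_def)
  qed
  have old: "coef J' G T = coef J F T" if T: "T \<subseteq> N" "card T = Suc k" for T
  proof -
    have "b ` T = T"
      using bN T by force
    \<comment> \<open>No element of \<open>v\<close> can occur in \<open>S\<close>, because its
      image \<open>i0\<close> is not in \<open>T\<close>.\<close>
    moreover have "S = T" if "b ` S = T" for S
    proof -
      have "b s = s" if "s \<in> S" for s
        using that \<open>b ` S = T\<close> T i0N by (auto simp: b_def)
      then show ?thesis
        using that by force
    qed
    ultimately have "{S\<in>Pow J. card S = Suc k \<and> b ` S = T} = {T}"
      using T N by blast
    moreover have "chi T \<alpha> = 1"
      using \<alpha>N T by (intro chi_eq_1) auto
    ultimately show ?thesis
      using top[of T] T NJ' by simp
  qed
  show thesis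
    using that[of i0 G] i0 vB red new old by (auto simp: J'_def)
qed

text \<open>Induction on the number of merged coordinates, which are collected in \<open>N\<close>.
  A merge bounds the coefficients of the sets through the new coordinate and leaves those of the
  sets within \<open>N\<close> unchanged, so the error does not accumulate. Finally everything
  outside \<open>N\<close> is set to \<open>0\<close>.\<close>

lemma small_top_coefs:
  assumes fin: "finite J" and deg: "deg_le J F (Suc k)"
    and F: "\<And>y. y \<in> cube J \<Longrightarrow> \<bar>F y\<bar> \<le> M" and M: "0 \<le> M" and \<epsilon>: "0 < \<epsilon>"
    and Q: "M * r / \<epsilon> + 1 \<le> real Q"
    and small: "(2 * Q + 1) ^ (m ^ k) < 2 ^ r" and size: "m * r \<le> card J"
  obtains J' G where "reduces J F J' G" "card J' = m"
    "\<And>T. T \<subseteq> J' \<Longrightarrow> card T = Suc k \<Longrightarrow> \<bar>coef J' G T\<bar> \<le> \<epsilon>"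
proof -
  \<comment> \<open>At least \<open>(m - j) * r\<close> unmerged coordinates are kept in reserve for
    the blocks still to come.\<close>
  have "\<exists>J' N G. reduces J F J' G \<and> N \<subseteq> J' \<and> card N = j \<and> (m - j) * r \<le> card (J' - N) \<and>
      (\<forall>T. T \<subseteq> N \<longrightarrow> card T = Suc k \<longrightarrow> \<bar>coef J' G T\<bar> \<le> \<epsilon>)" if "j \<le> m" for j
    using that
  proof (induction j)
    case 0
    have "reduces J F J F"
      by (simp add: reduces_subset)
    with size show ?case
      by (intro exI[of _ J] exI[of _ "{}"] exI[of _ F]) auto
  next
    case (Suc j)
    then obtain J' N G where G: "reduces J F J' G" and N: "N \<subseteq> J'" "card N = j"
      and room: "(m - j) * r \<le> card (J' - N)"
      and old: "\<And>T. T \<subseteq> N \<Longrightarrow> card T = Suc k \<Longrightarrow> \<bar>coef J' G T\<bar> \<le> \<epsilon>"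
      by auto
    have finJ': "finite J'"
      using G fin finite_subset by (auto simp: reduces_def)
    have finN: "finite N"
      using N(1) finJ' finite_subset by blast
    have split: "(m - j) * r = (m - Suc j) * r + r"
      using Suc.prems by (metis Suc_diff_le add.commute diff_Suc_Suc mult_Suc)
    with room have "r \<le> card (J' - N)"
      by simp
    then obtain B where B: "B \<subseteq> J' - N" "card B = r"
      by (meson obtain_subset_with_card_n)
    \<comment> \<open>There is one form for each \<open>k\<close>-element subset of the coordinates
      merged so far; \<open>m ^ k\<close> bounds their number uniformly over all blocks.\<close>
    have "(2 * Q + 1) ^ (card N choose k) \<le> (2 * Q + 1) ^ (m ^ k)"
    proof (rule power_increasing)
      show "card N choose k \<le> m ^ k"
      proof (cases "k \<le> j")
        case True
        then have "j choose k \<le> j ^ k"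
          by (rule binomial_le_pow)
        also have "\<dots> \<le> m ^ k"
          using Suc.prems by (intro power_mono) auto
        finally show ?thesis
          using N by simp
      qed (use N in \<open>simp add: binomial_eq_0\<close>)
    qed simp
    with small have small': "(2 * Q + 1) ^ (card N choose k) < 2 ^ card B"
      using B by simp
    have Q': "M * card B / \<epsilon> + 1 \<le> real Q"
      using Q B by simp
    obtain i0 H where H: "i0 \<in> B" "reduces J' G (insert i0 (J' - B)) H"
      and new: "\<And>T. T \<subseteq> N \<Longrightarrow> card T = k \<Longrightarrow> \<bar>coef (insert i0 (J' - B)) H (insert i0 T)\<bar> \<le> \<epsilon>"
      and same: "\<And>T. T \<subseteq> N \<Longrightarrow> card T = Suc k \<Longrightarrow> coef (insert i0 (J' - B)) H T = coef J' G T"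
      using merge_block[OF finJ' N(1) B(1) deg_le_reduces[OF G fin deg] reduces_bounded[OF G F] M \<epsilon> Q' small']
      by metis
    define J'' where "J'' = insert i0 (J' - B)"
    have i0N: "i0 \<notin> N"
      using H(1) B by blast
    have "reduces J F J'' H"
      using reduces_trans[OF G H(2)] by (simp add: J''_def)
    moreover have "insert i0 N \<subseteq> J''"
      using N B by (auto simp: J''_def)
    moreover have "card (insert i0 N) = Suc j"
      using i0N N finN by simp
    moreover have "(m - Suc j) * r \<le> card (J'' - insert i0 N)"
    proof -
      have "J'' - insert i0 N = (J' - N) - B"
        using H(1) by (auto simp: J''_def)
      moreover have "card ((J' - N) - B) = card (J' - N) - r"
        using B finJ' finite_subset[OF B(1)] by (simp add: card_Diff_subset)
      ultimately show ?thesis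
        using room split by simp
    qed
    moreover have "\<bar>coef J'' H T\<bar> \<le> \<epsilon>" if T: "T \<subseteq> insert i0 N" "card T = Suc k" for T
    proof (cases "i0 \<in> T")
      case True
      then have "card (T - {i0}) = k" "T - {i0} \<subseteq> N"
        using T by auto
      with new[of "T - {i0}"] True show ?thesis
        by (simp add: J''_def insert_absorb)
    next
      case False
      then have "T \<subseteq> N"
        using T by blast
      with T same old show ?thesis
        by (simp add: J''_def)
    qed
    ultimately show ?case
      by blast
  qed
  from this[of m] obtain J' N G where G: "reduces J F J' G" and N: "N \<subseteq> J'" "card N = m"
      and top: "\<And>T. T \<subseteq> N \<Longrightarrow> card T = Suc k \<Longrightarrow> \<bar>coef J' G T\<bar> \<le> \<epsilon>"
    by auto
  have finJ': "finite J'"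
    using G fin finite_subset by (auto simp: reduces_def)
  show thesis
  proof (rule that)
    show "reduces J F N G"
      by (rule reduces_trans[OF G reduces_subset[OF N(1)]])
    show "\<bar>coef N G T\<bar> \<le> \<epsilon>" if "T \<subseteq> N" "card T = Suc k" for T
      using top[OF that] coef_subset_top[OF finJ' N(1) deg_le_reduces[OF G fin deg] that] by simp
  qed (fact N)
qed

section \<open>Lowering the degree to zero\<close>

text \<open>The number of coordinates with which to start at degree \<open>k\<close> so that
  \<open>p\<close> are left at degree \<open>0\<close>. With \<open>m = dim_needed l p k\<close>,
  the step from degree \<open>Suc k\<close> uses \<open>m\<close> blocks of
  \<open>2 * l * m ^ k\<close> coordinates.\<close>

primrec dim_needed :: "nat \<Rightarrow> nat \<Rightarrow> nat \<Rightarrow> nat" where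
  "dim_needed l p 0 = p"
| "dim_needed l p (Suc k) = 2 * l * dim_needed l p k ^ Suc k"

lemma dim_needed_pos: "0 < l \<Longrightarrow> 0 < p \<Longrightarrow> 0 < dim_needed l p k"
  by (induction k) auto

text \<open>The exponent of \<open>2 * l\<close> in \<^term>\<open>dim_needed l p k\<close> is \<open>fact k * (1/1! + \<dots> + 1/k!)\<close>.\<close>

lemma dim_needed_le_aux:
  assumes "0 < l"
  shows "2 * l * dim_needed l p (Suc k) \<le> ((2 * l)\<^sup>2 * p) ^ fact (Suc k)"
proof (induction k)
  case 0
  show ?case
    by (simp add: power2_eq_square)
next
  case (Suc k)
  let ?K = "Suc (Suc k)"
  have "2 * l * dim_needed l p ?K = (2 * l)\<^sup>2 * dim_needed l p (Suc k) ^ ?K"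
    by (simp add: power2_eq_square)
  \<comment> \<open>As \<open>?K\<close> is at least 2, it absorbs the square; the additional factor
    \<open>2 * l\<close> in the statement is what lets the bound reproduce itself.\<close>
  also have "\<dots> \<le> (2 * l) ^ ?K * dim_needed l p (Suc k) ^ ?K"
    using assms by (intro mult_right_mono power_increasing) auto
  also have "\<dots> = (2 * l * dim_needed l p (Suc k)) ^ ?K"
    by (simp only: power_mult_distrib)
  also have "\<dots> \<le> (((2 * l)\<^sup>2 * p) ^ fact (Suc k)) ^ ?K"
    using Suc.IH by (rule power_mono) simp
  also have "\<dots> = ((2 * l)\<^sup>2 * p) ^ fact ?K"
    by (simp only: power_mult[symmetric] fact_Suc[of "Suc k"] mult.commute of_nat_id)
  finally show ?case .
qed

lemma dim_needed_le:
  assumes "0 < l"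
  shows "dim_needed l p k \<le> ((2 * l)\<^sup>2 * p) ^ fact k"
proof (cases k)
  case 0
  have "1 * p \<le> (2 * l)\<^sup>2 * p"
    using assms by (intro mult_right_mono) (auto simp: Suc_le_eq)
  with 0 show ?thesis
    by simp
next
  case (Suc j)
  have "1 * dim_needed l p k \<le> 2 * l * dim_needed l p k"
    using assms by (intro mult_right_mono) auto
  also have "\<dots> \<le> ((2 * l)\<^sup>2 * p) ^ fact k"
    unfolding Suc by (rule dim_needed_le_aux[OF assms])
  finally show ?thesis
    by simp
qed

text \<open>Discarding level \<open>Suc k\<close> removes at most \<open>m ^ Suc k\<close> terms,
  each of size at most \<open>\<epsilon>\<close>.\<close>

lemma truncate_degree:
  assumes fin: "finite J" and deg: "deg_le J F (Suc k)" and m: "card J = m"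
    and top: "\<And>T. T \<subseteq> J \<Longrightarrow> card T = Suc k \<Longrightarrow> \<bar>coef J F T\<bar> \<le> \<epsilon>" and \<epsilon>: "0 \<le> \<epsilon>"
  obtains g where "deg_le J g k" "\<And>y. y \<in> cube J \<Longrightarrow> \<bar>F y - g y\<bar> \<le> m ^ Suc k * \<epsilon>"
proof
  define a where "a S = (if card S \<le> k then coef J F S else 0)" for S
  define g where "g y = (\<Sum>S\<in>Pow J. a S * chi S y)" for y
  show "deg_le J g k"
    unfolding deg_le_def using coef_unique[OF fin, of _ g a] by (simp add: g_def a_def)
  fix y assume y: "y \<in> cube J"
  have "F y - g y = (\<Sum>S\<in>Pow J. (coef J F S - a S) * chi S y)"
    by (simp add: g_def coef_expansion[OF fin y, of F] sum_subtractf left_diff_distrib)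
  also have "\<dots> = (\<Sum>S\<in>{S. S \<subseteq> J \<and> card S = Suc k}. (coef J F S - a S) * chi S y)"
    using fin deg by (intro sum.mono_neutral_right) (auto simp: a_def deg_le_def)
  finally have "\<bar>F y - g y\<bar> \<le> (\<Sum>S\<in>{S. S \<subseteq> J \<and> card S = Suc k}. \<bar>(coef J F S - a S) * chi S y\<bar>)"
    by (simp only: sum_abs)
  also have "\<dots> \<le> (\<Sum>S\<in>{S. S \<subseteq> J \<and> card S = Suc k}. \<epsilon>)"
    using top by (intro sum_mono) (simp add: abs_mult a_def)
  also have "\<dots> = (m choose Suc k) * \<epsilon>"
    by (simp add: n_subsets[OF fin] m)
  also have "\<dots> \<le> m ^ Suc k * \<epsilon>"
  proof (cases "Suc k \<le> m")
    case True
    then have "m choose Suc k \<le> m ^ Suc k"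
      by (rule binomial_le_pow)
    then show ?thesis
      using \<epsilon> by (intro mult_right_mono of_nat_mono)
  qed (use \<epsilon> in \<open>simp add: binomial_eq_0\<close>)
  finally show "\<bar>F y - g y\<bar> \<le> m ^ Suc k * \<epsilon>" .
qed

text \<open>One round per degree: merge blocks, truncate, and continue with the truncated function.
  Truncation raises the uniform bound by \<open>\<eta>\<close>; the condition
  \<open>M + k * \<eta> \<le> 2\<close> keeps every function met within \<open>2\<close>, the bound
  for which \<open>Q\<close> is chosen, so the same \<open>Q\<close> and \<open>l\<close> serve all
  rounds.\<close>

lemma reduces_almost_constant:
  assumes l: "0 < l" and p: "0 < p" and \<epsilon>: "0 < \<epsilon>" and Q: "2 * real n / \<epsilon> + 1 \<le> real Q"
    and l_Q: "2 * Q + 1 \<le> 2 ^ l" and \<eta>: "real n ^ d * \<epsilon> \<le> \<eta>"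
  shows "k \<le> d \<Longrightarrow> finite J \<Longrightarrow> card J \<le> n \<Longrightarrow> dim_needed l p k \<le> card J \<Longrightarrow> deg_le J F k \<Longrightarrow>
    (\<And>y. y \<in> cube J \<Longrightarrow> \<bar>F y\<bar> \<le> M) \<Longrightarrow> M + k * \<eta> \<le> 2 \<Longrightarrow>
    \<exists>J' G c. reduces J F J' G \<and> p \<le> card J' \<and> (\<forall>y\<in>cube J'. \<bar>G y - c\<bar> \<le> k * \<eta>)"
proof (induction k arbitrary: J F M)
  case 0
  have "F y = coef J F {}" if y: "y \<in> cube J" for y
  proof -
    have "F y = (\<Sum>S\<in>Pow J. coef J F S * chi S y)"
      by (rule coef_expansion[OF \<open>finite J\<close> y])
    also have "\<dots> = (\<Sum>S\<in>{{}}. coef J F S * chi S y)"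
      using 0 finite_subset[OF _ \<open>finite J\<close>]
      by (intro sum.mono_neutral_right) (auto simp: deg_le_def card_gt_0_iff)
    finally show ?thesis
      by simp
  qed
  moreover have "reduces J F J F"
    by (simp add: reduces_subset)
  ultimately show ?case
    using 0 by (intro exI[of _ J] exI[of _ F] exI[of _ "coef J F {}"]) auto
next
  case (Suc k)
  define m where "m = dim_needed l p k"
  \<comment> \<open>As \<open>2 * Q + 1 \<le> 2 ^ l\<close>, the patterns of \<open>m ^ k\<close>
    forms number at most \<open>2 ^ (l * m ^ k)\<close>; the factor 2 makes the pigeonhole
    inequality strict.\<close>
  define r where "r = 2 * l * m ^ k"
  have m: "0 < m"
    unfolding m_def by (rule dim_needed_pos[OF l p])
  have size: "m * r \<le> card J"
    using Suc.prems(4) by (simp add: m_def r_def mult_ac)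
  have "r \<le> m * r"
    using m by simp
  with size Suc.prems have r: "r \<le> n"
    by linarith
  have n: "1 \<le> n"
    using size Suc.prems r m l by (auto simp: r_def Suc_le_eq intro: gr0I)
  have "0 \<le> real n ^ d * \<epsilon>"
    using \<epsilon> by simp
  with \<eta> have \<eta>0: "0 \<le> \<eta>"
    by linarith
  then have "0 \<le> Suc k * \<eta>"
    by simp
  with Suc.prems have M2: "M \<le> 2"
    by linarith
  have F2: "\<bar>F y\<bar> \<le> 2" if "y \<in> cube J" for y
    using Suc.prems(6)[OF that] M2 by linarith
  have Q': "2 * real r / \<epsilon> + 1 \<le> real Q"
  proof -
    have "2 * real r / \<epsilon> \<le> 2 * real n / \<epsilon>"
      using r \<epsilon> by (intro divide_right_mono) auto
    with Q show ?thesis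
      by linarith
  qed
  have small: "(2 * Q + 1) ^ (m ^ k) < 2 ^ r"
  proof -
    have "(2 * Q + 1) ^ (m ^ k) \<le> (2 ^ l) ^ (m ^ k)"
      using l_Q by (rule power_mono) simp
    also have "\<dots> = (2::nat) ^ (l * m ^ k)"
      by (simp add: power_mult)
    also have "\<dots> < 2 ^ r"
      using l m by (intro power_strict_increasing) (auto simp: r_def)
    finally show ?thesis .
  qed
  obtain J1 G1 where G1: "reduces J F J1 G1" "card J1 = m"
      and top: "\<And>T. T \<subseteq> J1 \<Longrightarrow> card T = Suc k \<Longrightarrow> \<bar>coef J1 G1 T\<bar> \<le> \<epsilon>"
    using small_top_coefs[OF Suc.prems(2,5) F2 _ \<epsilon> Q' small size] by auto
  have J1: "finite J1" "card J1 \<le> n"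
    using G1 Suc.prems(2,3) finite_subset card_mono[of J J1] by (auto simp: reduces_def)
  obtain g where g: "deg_le J1 g k"
      and close: "\<And>y. y \<in> cube J1 \<Longrightarrow> \<bar>G1 y - g y\<bar> \<le> m ^ Suc k * \<epsilon>"
    using truncate_degree[OF J1(1) deg_le_reduces[OF G1(1) Suc.prems(2,5)] G1(2) top] \<epsilon> by auto
  \<comment> \<open>All rounds share the error \<open>\<eta>\<close>, because
    \<open>m \<le> n\<close> and \<open>Suc k \<le> d\<close>.\<close>
  have "real m ^ Suc k \<le> real n ^ Suc k"
    using J1 G1 by (intro power_mono) auto
  also have "\<dots> \<le> real n ^ d"
    using n Suc.prems(1) by (intro power_increasing) auto
  finally have "real m ^ Suc k * \<epsilon> \<le> real n ^ d * \<epsilon>"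
    using \<epsilon> by (intro mult_right_mono) auto
  with \<eta> close have close': "\<bar>G1 y - g y\<bar> \<le> \<eta>" if "y \<in> cube J1" for y
    using that by fastforce
  have g_bound: "\<bar>g y\<bar> \<le> M + \<eta>" if "y \<in> cube J1" for y
    using reduces_bounded[OF G1(1) Suc.prems(6) that] close'[OF that] by linarith
  have "M + \<eta> + k * \<eta> \<le> 2"
    using Suc.prems(7) by (simp add: algebra_simps)
  from Suc.IH[OF _ J1 _ g g_bound this] Suc.prems(1) G1(2)
  obtain J2 G2 c where G2: "reduces J1 g J2 G2" "p \<le> card J2"
      and const: "\<And>y. y \<in> cube J2 \<Longrightarrow> \<bar>G2 y - c\<bar> \<le> k * \<eta>"
    by (auto simp: m_def)
  obtain \<alpha> b where *: "J2 \<subseteq> J1" "\<alpha> \<in> cube J1" "\<And>j. j \<in> J2 \<Longrightarrow> b j = j"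
      "\<And>i. i \<notin> J1 \<Longrightarrow> b i \<notin> J2" "\<And>y. y \<in> cube J2 \<Longrightarrow> G2 y = g (\<lambda>i. \<alpha> i + y (b i))"
    using reducesE[OF G2(1)] by metis
  \<comment> \<open>The parametrisation found for \<open>g\<close> is applied to \<open>G1\<close>
    itself; the two functions differ by at most \<open>\<eta>\<close> at every point of the
    subspace.\<close>
  define H where "H = (\<lambda>y. G1 (\<lambda>i. \<alpha> i + y (b i)))"
  have "reduces J1 G1 J2 H"
    by (rule reducesI[OF *(1-4)]) (simp_all add: H_def)
  then have "reduces J F J2 H"
    by (rule reduces_trans[OF G1(1)])
  moreover have "\<bar>H y - c\<bar> \<le> Suc k * \<eta>" if y: "y \<in> cube J2" for y
  proof -
    have "\<bar>H y - G2 y\<bar> \<le> \<eta>"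
      using close'[OF subst_in_cube[OF *(2,4) y]] *(5)[OF y] by (simp add: H_def)
    with const[OF y] show ?thesis
      by (simp add: distrib_right)
  qed
  ultimately show ?case
    using G2(2) by blast
qed

section \<open>From parametrised subspaces to the codimension\<close>

lemma F2_eq_cube: "F2 n = cube {..<n}"
  by (auto simp: F2_def cube_def not_less)

lemma character_eq_sg: "character n \<gamma> x = sg (ip n \<gamma> x)"
  by (simp add: character_def sg_def)

lemma sum_fun_apply: "(\<Sum>x\<in>A. g x) i = (\<Sum>x\<in>A. g x i)"
  by (induction A rule: infinite_finite_induct) auto

section \<open>Linear algebra of the parametrised subspaces\<close>

definition unit_vec :: "nat \<Rightarrow> nat \<Rightarrow> bit" where
  "unit_vec j = (\<lambda>i. if i = j then 1 else 0)"

lemma unit_vec_in_cube: "j \<in> J \<Longrightarrow> unit_vec j \<in> cube J"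
  by (auto simp: unit_vec_def cube_def)

lemma subspace_cube: "f2.subspace (cube J)"
  by (rule f2.subspaceI) (auto simp: cube_def f2_scale_def)

text \<open>The direction space of the affine subspace described by \<open>reduces\<close>.\<close>

definition pullback :: "(nat \<Rightarrow> nat) \<Rightarrow> nat set \<Rightarrow> (nat \<Rightarrow> bit) set" where
  "pullback b J = (\<lambda>y i. y (b i)) ` cube J"

lemma pullbackI: "y \<in> cube J \<Longrightarrow> (\<lambda>i. y (b i)) \<in> pullback b J"
  by (auto simp: pullback_def)

lemma pullbackE:
  assumes "v \<in> pullback b J"
  obtains y where "y \<in> cube J" "v = (\<lambda>i. y (b i))"
  using assms by (auto simp: pullback_def)

lemma subspace_pullback: "f2.subspace (pullback b J)"
proof (rule f2.subspaceI)
  show "0 \<in> pullback b J"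
    using pullbackI[OF zero_in_cube] by (simp add: zero_fun_def)
next
  fix v w assume "v \<in> pullback b J" "w \<in> pullback b J"
  then obtain y z where yz: "y \<in> cube J" "z \<in> cube J" "v = (\<lambda>i. y (b i))" "w = (\<lambda>i. z (b i))"
    by (metis pullbackE)
  have "y + z \<in> cube J"
    using yz subspace_cube f2.subspace_add by blast
  from pullbackI[OF this, of b] show "v + w \<in> pullback b J"
    using yz by (simp add: plus_fun_def)
next
  fix c v assume "v \<in> pullback b J"
  then obtain y where y: "y \<in> cube J" "v = (\<lambda>i. y (b i))"
    by (metis pullbackE)
  have "f2_scale c y \<in> cube J"
    using y subspace_cube f2.subspace_scale by blast
  from pullbackI[OF this, of b] show "f2_scale c v \<in> pullback b J"
    using y by (simp add: f2_scale_def)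
qed

lemma inj_on_pullback:
  assumes "\<And>j. j \<in> J \<Longrightarrow> b j = j"
  shows "inj_on (\<lambda>y i. y (b i)) (cube J)"
proof (rule inj_onI)
  fix y z assume yz: "y \<in> cube J" "z \<in> cube J" and eq: "(\<lambda>i. y (b i)) = (\<lambda>i. z (b i))"
  show "y = z"
  proof
    fix i
    show "y i = z i"
    proof (cases "i \<in> J")
      case True
      then show ?thesis
        using fun_cong[OF eq, of i] assms by simp
    qed (use yz in \<open>simp add: cube_def\<close>)
  qed
qed

text \<open>The pulled-back unit vectors span, and since \<open>b\<close> fixes \<open>J\<close>
  they restrict to the standard basis there, which gives independence.\<close>

lemma dim_pullback:
  assumes fin: "finite J" and b: "\<And>j. j \<in> J \<Longrightarrow> b j = j"
  shows "f2.dim (pullback b J) = card J"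
proof -
  define e where "e j = (\<lambda>i. unit_vec j (b i))" for j
  have e_J: "e j i = (if i = j then 1 else 0)" if "i \<in> J" for i j
    using that b by (simp add: e_def unit_vec_def)
  have inj: "inj_on e J"
  proof (rule inj_onI)
    fix j j' assume "j \<in> J" "j' \<in> J" "e j = e j'"
    then show "j = j'"
      using e_J[of j j] e_J[of j j'] by (auto split: if_splits)
  qed
  have "u (e j) = 0" if u: "(\<Sum>v\<in>e ` J. f2_scale (u v) v) = 0" and j: "j \<in> J" for u j
  proof -
    have "0 = (\<Sum>v\<in>e ` J. f2_scale (u v) v) j"
      using u by simp
    also have "\<dots> = (\<Sum>k\<in>J. if j = k then u (e k) else 0)"
      using j by (auto simp: sum.reindex[OF inj] sum_fun_apply f2_scale_def e_J intro!: sum.cong)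
    finally show ?thesis
      using j fin by simp
  qed
  then have indep: "f2.independent (e ` J)"
    using fin by (auto simp: f2.dependent_finite)
  have span: "pullback b J \<subseteq> f2.span (e ` J)"
  proof
    fix v assume "v \<in> pullback b J"
    then obtain y where y: "y \<in> cube J" "v = (\<lambda>i. y (b i))"
      by (rule pullbackE)
    have "v = (\<Sum>j\<in>J. f2_scale (y j) (e j))"
    proof
      fix i
      have "(\<Sum>j\<in>J. f2_scale (y j) (e j)) i = (\<Sum>j\<in>J. if b i = j then y j else 0)"
        by (auto simp: sum_fun_apply f2_scale_def e_def unit_vec_def intro!: sum.cong)
      also have "\<dots> = v i"
        using y fin by (auto simp: cube_def)
      finally show "v i = (\<Sum>j\<in>J. f2_scale (y j) (e j)) i"
        by simp
    qed
    then show "v \<in> f2.span (e ` J)"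
      by (simp only:) (intro f2.span_sum f2.span_scale f2.span_base imageI)
  qed
  have "e ` J \<subseteq> pullback b J"
    using pullbackI[OF unit_vec_in_cube] by (auto simp: e_def)
  from f2.dim_unique[OF this span indep] show ?thesis
    by (simp add: card_image inj)
qed

lemma ip_pullback:
  assumes J: "J \<subseteq> {..<n}" and b: "\<And>j. j \<in> J \<Longrightarrow> b j = j" and \<gamma>: "\<gamma> \<in> cube J"
  shows "ip n \<gamma> (\<lambda>i. y (b i)) = (\<Sum>j\<in>J. \<gamma> j * y j)"
proof -
  have "ip n \<gamma> (\<lambda>i. y (b i)) = (\<Sum>j\<in>J. \<gamma> j * y (b j))"
    unfolding ip_def using J \<gamma> by (intro sum.mono_neutral_right) (auto simp: cube_def)
  then show ?thesis
    using b by simp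
qed

text \<open>By \<open>ip_pullback\<close>, \<open>cube J\<close> pairs with the subspace through the
  standard form in the coordinates of \<open>J\<close>, which is nondegenerate. Hence
  \<open>cube J\<close> meets the annihilator only in \<open>0\<close>, and every
  \<open>\<gamma>\<close> agrees on the subspace with the \<open>w\<close> in \<open>cube J\<close>
  that has the same values on the pulled-back unit vectors.\<close>

lemma perp_complement_pullback:
  assumes J: "J \<subseteq> {..<n}" and b: "\<And>j. j \<in> J \<Longrightarrow> b j = j"
  shows "perp_complement n (pullback b J) (cube J)"
proof -
  have fin: "finite J"
    using J finite_subset by blast
  have JF: "cube J \<subseteq> F2 n"
    using J by (auto simp: cube_def F2_eq_cube)
  have "\<gamma> = 0" if \<gamma>: "\<gamma> \<in> cube J" "\<gamma> \<in> perp n (pullback b J)" for \<gamma>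
  proof
    fix j
    show "\<gamma> j = 0 j"
    proof (cases "j \<in> J")
      case True
      have "ip n \<gamma> (\<lambda>i. unit_vec j (b i)) = 0"
        using \<gamma>(2) pullbackI[OF unit_vec_in_cube[OF True], of b] by (simp add: perp_def)
      then have "0 = (\<Sum>i\<in>J. \<gamma> i * unit_vec j i)"
        using ip_pullback[OF J b \<gamma>(1), of "unit_vec j"] by simp
      also have "\<dots> = (\<Sum>i\<in>J. if i = j then \<gamma> i else 0)"
        by (intro sum.cong) (auto simp: unit_vec_def)
      finally show ?thesis
        using True fin by simp
    qed (use \<gamma> in \<open>simp add: cube_def\<close>)
  qed
  moreover have "0 \<in> cube J" "0 \<in> perp n (pullback b J)"
    by (auto simp: cube_def perp_def F2_def ip_def)
  ultimately have inter: "cube J \<inter> perp n (pullback b J) = {0}"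
    by blast
  have "\<exists>w u. \<gamma> = w + u \<and> w \<in> cube J \<and> u \<in> perp n (pullback b J)" if \<gamma>: "\<gamma> \<in> F2 n" for \<gamma>
  proof -
    define w where "w j = (if j \<in> J then ip n \<gamma> (\<lambda>i. unit_vec j (b i)) else 0)" for j
    have w: "w \<in> cube J"
      by (auto simp: w_def cube_def)
    have "ip n (\<gamma> - w) v = 0" if "v \<in> pullback b J" for v
    proof -
      obtain y where y: "y \<in> cube J" "v = (\<lambda>i. y (b i))"
        using \<open>v \<in> pullback b J\<close> by (rule pullbackE)
      have "ip n w v = (\<Sum>j\<in>J. w j * y j)"
        using ip_pullback[OF J b w] y by simp
      also have "\<dots> = (\<Sum>j\<in>J. \<Sum>i<n. \<gamma> i * (unit_vec j (b i) * y j))"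
        by (intro sum.cong) (simp_all add: w_def ip_def sum_distrib_right mult.assoc)
      also have "\<dots> = (\<Sum>i<n. \<gamma> i * (\<Sum>j\<in>J. unit_vec j (b i) * y j))"
        by (subst sum.swap) (simp add: sum_distrib_left)
      also have "\<dots> = ip n \<gamma> v"
        unfolding ip_def
      proof (intro sum.cong refl)
        fix i
        have "(\<Sum>j\<in>J. unit_vec j (b i) * y j) = (\<Sum>j\<in>J. if b i = j then y j else 0)"
          by (intro sum.cong) (auto simp: unit_vec_def)
        also have "\<dots> = v i"
          using y fin by (auto simp: cube_def)
        finally show "\<gamma> i * (\<Sum>j\<in>J. unit_vec j (b i) * y j) = \<gamma> i * v i"
          by simp
      qed
      finally have "ip n w v = ip n \<gamma> v" .
      moreover have "ip n (\<gamma> - w) v = ip n \<gamma> v - ip n w v"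
        by (simp add: ip_def left_diff_distrib sum_subtractf)
      ultimately show ?thesis
        by simp
    qed
    moreover have "\<gamma> - w \<in> F2 n"
      using \<gamma> w JF subspace_cube f2.subspace_diff unfolding F2_eq_cube by blast
    ultimately have "\<gamma> - w \<in> perp n (pullback b J)"
      by (simp add: perp_def)
    moreover have "\<gamma> = w + (\<gamma> - w)"
      by simp
    ultimately show ?thesis
      using w by blast
  qed
  moreover have "w + u \<in> F2 n" if "w \<in> cube J" "u \<in> perp n (pullback b J)" for w u
    using that JF subspace_cube f2.subspace_add unfolding F2_eq_cube perp_def by blast
  ultimately have "{w + u | w u. w \<in> cube J \<and> u \<in> perp n (pullback b J)} = F2 n"
    by blast
  with inter JF subspace_cube show ?thesis
    by (simp add: perp_complement_def)
qed

text \<open>A nontrivial character has mean zero, so subtracting \<open>c\<close> does not change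
  the coefficient, which is then an average of numbers of size at most
  \<open>\<delta>\<close>.\<close>

lemma delta_regular_pullback:
  assumes J: "J \<subseteq> {..<n}" and b: "\<And>j. j \<in> J \<Longrightarrow> b j = j"
    and const: "\<And>y. y \<in> cube J \<Longrightarrow> \<bar>f (\<lambda>i. \<alpha> i + y (b i)) - c\<bar> \<le> \<delta>"
  shows "delta_regular n f \<delta> \<alpha> (pullback b J)"
  unfolding delta_regular_def
proof (intro exI[of _ "cube J"] conjI ballI impI)
  show "perp_complement n (pullback b J) (cube J)"
    by (rule perp_complement_pullback[OF J b])
  fix \<gamma> :: "nat \<Rightarrow> bit" assume \<gamma>: "\<gamma> \<in> cube J" "\<gamma> \<noteq> 0"
  have fin: "finite J"
    using J finite_subset by blast
  define S where "S = {i. \<gamma> i \<noteq> 0}"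
  define H where "H y = f (\<lambda>i. \<alpha> i + y (b i))" for y
  have S: "S \<subseteq> J" "S \<noteq> {}"
    using \<gamma> by (auto simp: S_def cube_def fun_eq_iff)
  have char: "character n \<gamma> (\<lambda>i. y (b i)) = chi S y" for y
  proof -
    have "character n \<gamma> (\<lambda>i. y (b i)) = (\<Prod>j\<in>J. sg (\<gamma> j * y j))"
      by (simp add: character_eq_sg ip_pullback[OF J b \<gamma>(1)] sg_sum)
    also have "\<dots> = (\<Prod>j\<in>S. sg (\<gamma> j * y j))"
      using S fin by (intro prod.mono_neutral_right) (auto simp: S_def)
    also have "\<dots> = chi S y"
      unfolding chi_def by (intro prod.cong) (auto simp: S_def bit_not_zero_iff)
    finally show ?thesis .
  qed
  have "restr_fourier n f \<alpha> (pullback b J) \<gamma> = (\<Sum>y\<in>cube J. H y * chi S y) / 2 ^ card J"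
    unfolding restr_fourier_def pullback_def
    by (simp add: sum.reindex[OF inj_on_pullback[OF b]] card_image[OF inj_on_pullback[OF b]]
        card_cube[OF fin] char H_def plus_fun_def add.commute)
  also have "(\<Sum>y\<in>cube J. H y * chi S y) = (\<Sum>y\<in>cube J. (H y - c) * chi S y) + c * (\<Sum>y\<in>cube J. chi S y * chi {} y)"
    by (simp add: left_diff_distrib sum_subtractf sum_distrib_left)
  also have "(\<Sum>y\<in>cube J. chi S y * chi {} y) = 0"
    using S chi_orthogonal[OF fin S(1), of "{}"] by simp
  finally have "restr_fourier n f \<alpha> (pullback b J) \<gamma> = coef J (\<lambda>y. H y - c) S"
    by (simp add: coef_def)
  then show "\<bar>restr_fourier n f \<alpha> (pullback b J) \<gamma>\<bar> \<le> \<delta>"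
    using abs_coef_le[OF fin, of "\<lambda>y. H y - c" \<delta> S] const by (simp add: H_def)
qed

lemma regular_codim_le:
  assumes red: "reduces {..<n} f J G" and const: "\<And>y. y \<in> cube J \<Longrightarrow> \<bar>G y - c\<bar> \<le> \<delta>"
  shows "regular_codim n f \<delta> \<le> n - card J"
proof -
  obtain \<alpha> b where *: "J \<subseteq> {..<n}" "\<alpha> \<in> cube {..<n}" "\<And>j. j \<in> J \<Longrightarrow> b j = j"
      "\<And>i. i \<notin> {..<n} \<Longrightarrow> b i \<notin> J" "\<And>y. y \<in> cube J \<Longrightarrow> G y = f (\<lambda>i. \<alpha> i + y (b i))"
    using reducesE[OF red] by metis
  let ?C = "{n - f2.dim V | \<alpha> V. \<alpha> \<in> F2 n \<and> f2.subspace V \<and> V \<subseteq> F2 n \<and> delta_regular n f \<delta> \<alpha> V}"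
  have "pullback b J \<subseteq> F2 n"
    using *(4) unfolding F2_eq_cube pullback_def by (auto simp: cube_def)
  moreover have "delta_regular n f \<delta> \<alpha> (pullback b J)"
    using const *(5) by (intro delta_regular_pullback[OF *(1,3)]) auto
  moreover have "f2.dim (pullback b J) = card J"
    using *(1,3) finite_subset by (intro dim_pullback) auto
  ultimately have "n - card J \<in> ?C"
    using *(2) subspace_pullback[of b J] unfolding F2_eq_cube[symmetric] mem_Collect_eq by metis
  \<comment> \<open>Finiteness is what makes \<open>Min\<close> a lower bound; each difference is at
    most \<open>n\<close>.\<close>
  moreover have "finite ?C"
    by (rule finite_subset[of _ "{..n}"]) auto
  ultimately show ?thesis
    unfolding regular_codim_def by (rule Min_le[rotated])
qed

text \<open>Passing from a set to its indicator vector turns \<open>chi\<close> into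
  \<open>character\<close> and cardinality into Hamming weight.\<close>

lemma deg_le_fourier_degree: "deg_le {..<n} f (fourier_degree n f)"
  unfolding deg_le_def
proof (intro allI impI)
  fix S assume S: "S \<subseteq> {..<n}" "fourier_degree n f < card S"
  define \<gamma> :: "nat \<Rightarrow> bit" where "\<gamma> = (\<lambda>i. if i \<in> S then 1 else 0)"
  have \<gamma>: "\<gamma> \<in> F2 n"
    using S by (auto simp: \<gamma>_def F2_eq_cube cube_def)
  have weight: "hamming_weight n \<gamma> = card S"
    unfolding hamming_weight_def using S by (intro arg_cong[where f = card]) (auto simp: \<gamma>_def)
  let ?H = "{hamming_weight n \<gamma> | \<gamma>. \<gamma> \<in> F2 n \<and> fourier n f \<gamma> \<noteq> 0}"
  have "?H \<subseteq> hamming_weight n ` F2 n"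
    by auto
  then have fin: "finite (insert 0 ?H)"
    using finite_cube[of "{..<n}"] finite_subset by (auto simp: F2_eq_cube)
  have "h \<le> fourier_degree n f" if "h \<in> ?H" for h
    unfolding fourier_degree_def by (rule Max_ge[OF fin insertI2[OF that]])
  then have "fourier n f \<gamma> = 0"
    using \<gamma> weight S(2) by fastforce
  moreover have "character n \<gamma> x = chi S x" for x
  proof -
    have "character n \<gamma> x = (\<Prod>i<n. sg (\<gamma> i * x i))"
      by (simp add: character_eq_sg ip_def sg_sum)
    also have "\<dots> = (\<Prod>i\<in>S. sg (\<gamma> i * x i))"
      using S by (intro prod.mono_neutral_right) (auto simp: \<gamma>_def)
    finally show ?thesis
      by (simp add: chi_def \<gamma>_def)
  qed
  ultimately show "coef {..<n} f S = 0"
    by (simp add: coef_def fourier_def F2_eq_cube card_cube)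
qed

section \<open>Choice of the parameters and the final estimate\<close>

lemma regular_codim_bound:
  assumes n: "2 \<le> n" and \<delta>: "0 < \<delta>" "\<delta> < 1" and f: "\<And>x. x \<in> F2 n \<Longrightarrow> \<bar>f x\<bar> \<le> 1"
    and d: "fourier_degree n f = d" and p: "0 < p"
    and l: "(real n / \<delta>) ^ (2 * d + 5) \<le> 2 ^ l" and size: "((2 * l)\<^sup>2 * p) ^ fact d \<le> n"
  shows "p \<le> n" "regular_codim n f \<delta> \<le> n - p"
proof -
  define u where "u = real n / \<delta>"
  \<comment> \<open>One truncation then costs at most
    \<open>real n ^ d * \<epsilon> = \<eta>\<close>, so \<open>d\<close> of them stay within
    \<open>\<delta>\<close>; the denominator \<open>d + 1\<close> also covers
    \<open>d = 0\<close>.\<close>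
  define \<epsilon> where "\<epsilon> = \<delta> / ((d + 1) * real n ^ d)"
  define Q where "Q = nat \<lceil>2 * real n / \<epsilon>\<rceil> + 1"
  define \<eta> where "\<eta> = \<delta> / (d + 1)"
  have n_le_u: "real n \<le> u"
    using n \<delta> by (simp add: u_def le_divide_eq mult_left_le)
  then have u: "2 \<le> u"
    using n by linarith
  have \<epsilon>: "0 < \<epsilon>"
    using n \<delta> by (simp add: \<epsilon>_def)
  have n\<epsilon>: "real n / \<epsilon> = (d + 1) * real n ^ d * u"
    using n \<delta> by (simp add: \<epsilon>_def u_def field_simps)
  have ge1: "1 \<le> real n / \<epsilon>"
  proof -
    have "1 * 1 * 1 \<le> real (d + 1) * real n ^ d * u"
      using u n by (intro mult_mono one_le_power) auto
    then show ?thesis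
      by (simp only: n\<epsilon>)
  qed
  have "real (2 * Q + 1) = 2 * real_of_int \<lceil>2 * (real n / \<epsilon>)\<rceil> + 3"
    using ge1 by (simp add: Q_def)
  also have "\<dots> \<le> 2 * (2 * (real n / \<epsilon>) + 1) + 3"
    by (intro add_right_mono mult_left_mono of_int_ceiling_le_add_one) simp
  also have "\<dots> \<le> 2 ^ 4 * (real n / \<epsilon>)"
    using ge1 by simp
  also have "\<dots> = 2 ^ 4 * ((d + 1) * real n ^ d * u)"
    by (simp only: n\<epsilon>)
  \<comment> \<open>From \<open>2 \<le> u\<close> and \<open>n \<le> u\<close> follow
    \<open>2 ^ 4 \<le> u ^ 4\<close>, \<open>d + 1 \<le> u ^ d\<close> and
    \<open>n ^ d \<le> u ^ d\<close>, whence the exponent \<open>2 * d + 5\<close>.\<close>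
  also have "\<dots> \<le> u ^ 4 * (u ^ d * u ^ d * u)"
  proof -
    have "real (d + 1) \<le> 2 ^ d"
      using less_exp[of d] by (metis Suc_eq_plus1 Suc_leI of_nat_le_iff of_nat_numeral of_nat_power)
    also have "\<dots> \<le> u ^ d"
      using u by (intro power_mono) auto
    finally show ?thesis
      using u n_le_u by (intro mult_mono power_mono) auto
  qed
  also have "\<dots> = u ^ (2 * d + 5)"
  proof -
    have "2 * d + 5 = 4 + (d + d + 1)"
      by simp
    then show ?thesis
      by (simp only: power_add power_one_right)
  qed
  also have "\<dots> \<le> 2 ^ l"
    using l by (simp add: u_def)
  finally have l_Q: "2 * Q + 1 \<le> 2 ^ l"
    by (metis of_nat_le_iff of_nat_numeral of_nat_power)
  have l_pos: "0 < l"
    using l_Q by (cases l) (auto simp: Q_def)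
  have Q: "2 * real n / \<epsilon> + 1 \<le> real Q"
    unfolding Q_def using of_nat_ceiling[of "2 * real n / \<epsilon>"] by linarith
  have \<eta>: "real n ^ d * \<epsilon> \<le> \<eta>"
    using n \<delta> by (simp add: \<epsilon>_def \<eta>_def)
  have d\<eta>: "d * \<eta> \<le> \<delta>"
    using \<delta> by (simp add: \<eta>_def field_simps)
  have need: "dim_needed l p d \<le> card {..<n}"
    using dim_needed_le[OF l_pos, of p d] size by simp
  have "1 + d * \<eta> \<le> 2"
    using d\<eta> \<delta> by linarith
  moreover have "\<bar>f y\<bar> \<le> 1" if "y \<in> cube {..<n}" for y
    using f that by (simp add: F2_eq_cube)
  moreover have "deg_le {..<n} f d"
    using deg_le_fourier_degree[of n f] d by simp
  ultimately have "\<exists>J G c. reduces {..<n} f J G \<and> p \<le> card J \<and> (\<forall>y\<in>cube J. \<bar>G y - c\<bar> \<le> d * \<eta>)"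
    using reduces_almost_constant[OF l_pos p \<epsilon> Q l_Q \<eta> order.refl _ _ need, of f 1] by simp
  then obtain J G c where red: "reduces {..<n} f J G" "p \<le> card J"
      and const: "\<And>y. y \<in> cube J \<Longrightarrow> \<bar>G y - c\<bar> \<le> d * \<eta>"
    by blast
  have "J \<subseteq> {..<n}"
    using red by (auto simp: reduces_def)
  then have "card J \<le> n"
    using card_mono[of "{..<n}" J] by simp
  moreover have "regular_codim n f \<delta> \<le> n - card J"
    using const d\<eta> by (intro regular_codim_le[OF red(1), of c]) (meson order_trans)
  ultimately show "p \<le> n" "regular_codim n f \<delta> \<le> n - p"
    using red(2) by linarith+
qed

text \<open>On a single point every function is constant. This bound serves the case in which the
  floor in the theorem is \<open>0\<close>.\<close>

lemma regular_codim_le_n: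
  assumes "0 \<le> \<delta>"
  shows "regular_codim n f \<delta> \<le> n"
proof -
  have "reduces {..<n} f {} f"
    by (rule reduces_subset) simp
  moreover have "\<bar>f y - f (\<lambda>_. 0)\<bar> \<le> \<delta>" if "y \<in> cube {}" for y
  proof -
    have "y = (\<lambda>_. 0)"
      using that by (auto simp: cube_def)
    with assms show ?thesis
      by simp
  qed
  ultimately show ?thesis
    using regular_codim_le[of n f "{}" f "f (\<lambda>_. 0)" \<delta>] by simp
qed

theorem theorem1p1:
  fixes d :: nat
  shows "\<exists>c::real. c > 0 \<and>
    (\<forall>(n::nat) (\<delta>::real) (f :: (nat \<Rightarrow> bit) \<Rightarrow> real).
       n \<ge> 2 \<longrightarrow> 0 < \<delta> \<longrightarrow> \<delta> < 1 \<longrightarrow> (\<forall>x\<in>F2 n. f x \<in> {-1..1}) \<longrightarrow> fourier_degree n f = d \<longrightarrow>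
       int (regular_codim n f \<delta>) \<le> int n -
         \<lfloor>c * (real n powr (1 / fact d) * (log 2 (real n / \<delta>)) powr (-2))\<rfloor>)"
proof -
  \<comment> \<open>Chosen so that \<open>2 * l \<le> C * L\<close> below: rounding
    \<open>(2 * d + 5) * L\<close> up costs at most \<open>1\<close>, and \<open>1 \<le> L\<close>
    because \<open>2 \<le> n\<close>.\<close>
  define C :: real where "C = 2 * (2 * d + 6)"
  have C: "0 < C"
    by (simp add: C_def)
  have "int (regular_codim n f \<delta>) \<le>
      int n - \<lfloor>1 / C\<^sup>2 * (real n powr (1 / fact d) * (log 2 (real n / \<delta>)) powr (-2))\<rfloor>"
    if n: "2 \<le> n" and \<delta>: "0 < \<delta>" "\<delta> < 1" and f: "\<forall>x\<in>F2 n. f x \<in> {-1..1}"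
      and d: "fourier_degree n f = d" for n \<delta> and f :: "(nat \<Rightarrow> bit) \<Rightarrow> real"
  proof -
    define L where "L = log 2 (real n / \<delta>)"
    define R where "R = real n powr (1 / fact d)"
    define p where "p = nat \<lfloor>1 / C\<^sup>2 * (R * L powr (-2))\<rfloor>"
    define l where "l = nat \<lceil>(2 * d + 5) * L\<rceil>"
    have "2 \<le> real n / \<delta>"
    proof -
      have "2 * \<delta> \<le> 2"
        using \<delta> by simp
      then show ?thesis
        using n \<delta> by (simp add: le_divide_eq)
    qed
    then have L: "1 \<le> L" and pow_L: "2 powr L = real n / \<delta>"
      by (simp_all add: L_def le_log_iff)
    have "0 \<le> 1 / C\<^sup>2 * (R * L powr (-2))"
      by (simp add: R_def)
    then have p: "real p \<le> 1 / C\<^sup>2 * (R * L powr (-2))" "\<lfloor>1 / C\<^sup>2 * (R * L powr (-2))\<rfloor> = int p"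
      by (simp_all add: p_def)
    have "(real n / \<delta>) ^ (2 * d + 5) = 2 powr ((2 * d + 5) * L)"
      by (simp flip: pow_L add: powr_powr powr_realpow[symmetric] mult.commute)
    also have "\<dots> \<le> 2 powr l"
      unfolding l_def by (intro powr_mono of_nat_ceiling) auto
    finally have l_ge: "(real n / \<delta>) ^ (2 * d + 5) \<le> 2 ^ l"
      by (simp add: powr_realpow)
    have "0 \<le> (2 * d + 5) * L"
      using L by simp
    then have "real l \<le> (2 * d + 5) * L + 1"
      unfolding l_def using of_int_ceiling_le_add_one[of "(2 * d + 5) * L"] by linarith
    also have "\<dots> \<le> (2 * d + 6) * L"
      using L by (simp add: algebra_simps)
    finally have l_le: "2 * real l \<le> C * L"
      by (simp add: C_def algebra_simps)
    \<comment> \<open>The factor \<open>(C * L)\<^sup>2\<close> coming from \<open>l\<close> cancels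
      against \<open>1 / C\<^sup>2\<close> and \<open>L powr (-2)\<close> in \<open>p\<close>; what
      remains is \<open>R\<close>, whose power \<open>fact d\<close> is \<open>n\<close>.\<close>
    have "real ((2 * l)\<^sup>2 * p) = (2 * real l)\<^sup>2 * real p"
      by simp
    also have "\<dots> \<le> (C * L)\<^sup>2 * (1 / C\<^sup>2 * (R * L powr (-2)))"
      by (rule mult_mono[OF power_mono[OF l_le] p(1)]) auto
    also have "\<dots> = R"
      using C L by (simp add: powr_minus powr_numeral field_simps power_mult_distrib)
    finally have "real ((2 * l)\<^sup>2 * p) ^ fact d \<le> R ^ fact d"
      by (intro power_mono) auto
    also have "\<dots> = real n"
      using n by (simp add: R_def powr_realpow[symmetric] powr_powr)
    finally have size: "((2 * l)\<^sup>2 * p) ^ fact d \<le> n"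
      by (metis of_nat_le_iff of_nat_power)
    have "int (regular_codim n f \<delta>) \<le> int n - int p"
    proof (cases "p = 0")
      case True
      then show ?thesis
        using regular_codim_le_n[of \<delta> n f] \<delta> by simp
    next
      case False
      have "\<bar>f x\<bar> \<le> 1" if "x \<in> F2 n" for x
        using f that by (auto simp: abs_le_iff)
      from regular_codim_bound[OF n \<delta> this d _ l_ge size] False show ?thesis
        by auto
    qed
    then show ?thesis
      unfolding p(2)[unfolded R_def L_def] .
  qed
  moreover have "0 < 1 / C\<^sup>2"
    using C by simp
  ultimately show ?thesis
    by blast
qed

end
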